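(* Let $p>2$ and let $\Sigma^n$ be a complete non-compact helix-type hypersurface contained in a slab of a pseudo-hyperbolic manifold $\mathbb{R}\times_{e^t}M^n$ with $\lambda_{1,p}(\Sigma)=0$. If the mean curvature $H$ of $\Sigma^n$ (not necessarily constant) satisfies $H^2\leq1$, then $\Sigma^n$ is a slice.
   Context: Let $(M^n,\langle\cdot,\cdot\rangle_M)$ be a connected oriented $n$-dimensional Riemannian manifold, $n\geq2$. The pseudo-hyperbolic manifold $\mathbb{R}\times_{e^t}M^n$ is the product manifold $\mathbb{R}\times M^n$ with the metric $dt^2+e^{2t}\langle\cdot,\cdot\rangle_M$; $\partial_t$ is the unit coordinate vector field tangent to $\mathbb{R}$. The slices are the hypersurfaces $M^n_t=\{t\}\times M^n$, $t\in\mathbb{R}$. A hypersurface is given by an isometric immersion $x:\Sigma^n\to\mathbb{R}\times_{e^t}M^n$ of a connected manifold $\Sigma^n$ (with the induced metric), with unit normal field $N$, shape operator $A(X)=-\overline{\nabla}_XN$ (where $\overline\nabla$ is the Levi-Civita connection of the ambient space) and mean curvature $H=\frac1n\mathrm{tr}(A)$. It is contained in a slab if $x(\Sigma)\subset[t_1,t_2]\times M^n$ for some real $t_1<t_2$. It is of helix type if the angle function $\langle N,\partial_t\rangle$ is constant on $\Sigma^n$. "$\Sigma^n$ is a slice" means $x(\Sigma^n)=M^n_t$ for some $t\in\mathbb{R}$. Here $\lambda_{1,p}(\Sigma)=\inf\{\int_\Sigma|\nabla u|^p/\int_\Sigma|u|^p: u\in W^{1,p}_0(\Sigma)\setminus\{0\}\}$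 is the first eigenvalue of the $p$-Laplacian $\Delta_pu=\mathrm{div}(|\nabla u|^{p-2}\nabla u)$ on $\Sigma^n$. *)

theory Defs
  imports "HOL-Analysis.Analysis"
begin

section \<open>Smooth maps between Euclidean spaces\<close>

primrec times_differentiable_on ::
  "nat \<Rightarrow> 'a::euclidean_space set \<Rightarrow> ('a \<Rightarrow> 'b::euclidean_space) \<Rightarrow> bool" where
  "times_differentiable_on 0 U f \<longleftrightarrow> continuous_on U f"
| "times_differentiable_on (Suc k) U f \<longleftrightarrow>
     (\<forall>y\<in>U. f differentiable (at y)) \<and>
     (\<forall>v. times_differentiable_on k U (\<lambda>y. frechet_derivative f (at y) v))"

text \<open>Only used for open \<open>U\<close>, where it is the usual notion of a \<open>C\<^sup>\<infinity>\<close> map.\<close>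

definition smooth_on :: "'a::euclidean_space set \<Rightarrow> ('a \<Rightarrow> 'b::euclidean_space) \<Rightarrow> bool" where
  "smooth_on U f \<longleftrightarrow> (\<forall>k. times_differentiable_on k U f)"


section \<open>Riemannian manifolds\<close>

text \<open>
  A manifold is a whole (Hausdorff, second countable) type \<open>'a\<close> together with an atlas indexed by
  the set \<open>indices\<close>; the chart \<open>i\<close> has domain \<open>cdom i\<close> and coordinate map \<open>coord i\<close> into the
  model space \<open>'e\<close>. A tangent vector at \<open>q\<close> is given by its coordinates with respect to each chart
  around \<open>q\<close>. The metric is given by its coordinate representations: \<open>metric i q v w\<close> is the inner
  product of the tangent vectors at \<open>q\<close> whose coordinates in chart \<open>i\<close> are \<open>v\<close> and \<open>w\<close>. Values
  at points \<open>q\<close> outside \<open>cdom i\<close> are irrelevant throughout.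
\<close>

record ('i, 'a, 'e) rmfd =
  indices :: "'i set"
  cdom :: "'i \<Rightarrow> 'a set"
  coord :: "'i \<Rightarrow> 'a \<Rightarrow> 'e"
  metric :: "'i \<Rightarrow> 'a \<Rightarrow> 'e \<Rightarrow> 'e \<Rightarrow> real"

definition charts_at :: "('i, 'a, 'e) rmfd \<Rightarrow> 'a \<Rightarrow> 'i set" where
  "charts_at M q = {i \<in> indices M. q \<in> cdom M i}"

text \<open>An arbitrary chart around \<open>q\<close>, used to evaluate quantities which do not depend on the chart.\<close>

definition chart_at :: "('i, 'a, 'e) rmfd \<Rightarrow> 'a \<Rightarrow> 'i" where
  "chart_at M q = (SOME i. i \<in> charts_at M q)"

definition param :: "('i, 'a, 'e) rmfd \<Rightarrow> 'i \<Rightarrow> 'e \<Rightarrow> 'a" where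
  "param M i = inv_into (cdom M i) (coord M i)"

definition transition_deriv ::
  "('i, 'a, 'e::euclidean_space) rmfd \<Rightarrow> 'i \<Rightarrow> 'i \<Rightarrow> 'a \<Rightarrow> 'e \<Rightarrow> 'e" where
  "transition_deriv M i j q = frechet_derivative (coord M j \<circ> param M i) (at (coord M i q))"

definition smooth_manifold ::
  "('i, 'a::{t2_space, second_countable_topology}, 'e::euclidean_space) rmfd \<Rightarrow> bool" where
  "smooth_manifold M \<longleftrightarrow>
     (\<Union>i\<in>indices M. cdom M i) = UNIV \<and>
     (\<forall>i\<in>indices M. open (cdom M i) \<and> open (coord M i ` cdom M i) \<and>
        homeomorphism (cdom M i) (coord M i ` cdom M i) (coord M i) (param M i)) \<and>
     (\<forall>i\<in>indices M. \<forall>j\<in>indices M.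
        smooth_on (coord M i ` (cdom M i \<inter> cdom M j)) (coord M j \<circ> param M i))"

definition riemannian_metric ::
  "('i, 'a, 'e::euclidean_space) rmfd \<Rightarrow> bool" where
  "riemannian_metric M \<longleftrightarrow>
     (\<forall>q. \<forall>i\<in>charts_at M q.
        bilinear (metric M i q) \<and>
        (\<forall>v w. metric M i q v w = metric M i q w v) \<and>
        (\<forall>v. v \<noteq> 0 \<longrightarrow> metric M i q v v > 0)) \<and>
     (\<forall>q. \<forall>i\<in>charts_at M q. \<forall>j\<in>charts_at M q. \<forall>v w.
        metric M i q v w =
        metric M j q (transition_deriv M i j q v) (transition_deriv M i j q w)) \<and>
     (\<forall>i\<in>indices M. \<forall>v w.
        smooth_on (coord M i ` cdom M i) (\<lambda>y. metric M i (param M i y) v w))"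

definition riemannian_manifold ::
  "('i, 'a::{t2_space, second_countable_topology}, 'e::euclidean_space) rmfd \<Rightarrow> bool" where
  "riemannian_manifold M \<longleftrightarrow> smooth_manifold M \<and> riemannian_metric M"

text \<open>The atlas is an oriented one: its transition maps have positive Jacobian determinant.\<close>

definition oriented :: "('i, 'a, real^'n) rmfd \<Rightarrow> bool" where
  "oriented M \<longleftrightarrow>
     (\<forall>q. \<forall>i\<in>charts_at M q. \<forall>j\<in>charts_at M q. det (matrix (transition_deriv M i j q)) > 0)"


section \<open>Distance and completeness\<close>

definition speed :: "('i, 'a, 'e::euclidean_space) rmfd \<Rightarrow> (real \<Rightarrow> 'a) \<Rightarrow> real \<Rightarrow> real" where
  "speed M \<gamma> t =
     (let i = chart_at M (\<gamma> t); v = vector_derivative (coord M i \<circ> \<gamma>) (at t)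
      in sqrt (metric M i (\<gamma> t) v v))"

text \<open>
  As in the library notion \<^const>\<open>piecewise_C1_differentiable_on\<close>, the velocity is allowed to be
  unbounded near the finitely many exceptional points. The length is an extended real number, so
  this does not affect the infimum defining the distance.
\<close>

definition piecewise_C1_curve ::
  "('i, 'a::topological_space, 'e::euclidean_space) rmfd \<Rightarrow> (real \<Rightarrow> 'a) \<Rightarrow> bool" where
  "piecewise_C1_curve M \<gamma> \<longleftrightarrow>
     continuous_on {0..1} \<gamma> \<and>
     (\<exists>F. finite F \<and> (\<forall>i\<in>indices M.
        (coord M i \<circ> \<gamma>) C1_differentiable_on (({0..1} - F) \<inter> \<gamma> -` cdom M i)))"

definition curve_length :: "('i, 'a, 'e::euclidean_space) rmfd \<Rightarrow> (real \<Rightarrow> 'a) \<Rightarrow> ennreal" where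
  "curve_length M \<gamma> = (\<integral>\<^sup>+ t\<in>{0..1}. ennreal (speed M \<gamma> t) \<partial>lborel)"

definition riemannian_dist ::
  "('i, 'a::topological_space, 'e::euclidean_space) rmfd \<Rightarrow> 'a \<Rightarrow> 'a \<Rightarrow> ennreal" where
  "riemannian_dist M a b =
     Inf {curve_length M \<gamma> | \<gamma>. piecewise_C1_curve M \<gamma> \<and> \<gamma> 0 = a \<and> \<gamma> 1 = b}"

definition complete_manifold ::
  "('i, 'a::topological_space, 'e::euclidean_space) rmfd \<Rightarrow> bool" where
  "complete_manifold M \<longleftrightarrow>
     (\<forall>X :: nat \<Rightarrow> 'a.
        (\<forall>e>0. \<exists>K. \<forall>m\<ge>K. \<forall>n\<ge>K. riemannian_dist M (X m) (X n) < e) \<longrightarrow>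
        (\<exists>a. \<forall>e>0. \<exists>K. \<forall>n\<ge>K. riemannian_dist M (X n) a < e))"


section \<open>Volume, Sobolev spaces and the first eigenvalue of the p-Laplacian\<close>

definition gram_det :: "('i, 'a, real^'n) rmfd \<Rightarrow> 'i \<Rightarrow> 'a \<Rightarrow> real" where
  "gram_det M i q = det ((\<chi> a b. metric M i q (axis a 1) (axis b 1)) :: real^'n^'n)"

text \<open>The unique Borel measure with \<open>dvol = sqrt (det g) dy\<close> in every chart.\<close>

definition volume :: "('i, 'a::topological_space, real^'n) rmfd \<Rightarrow> 'a measure" where
  "volume M = (THE \<mu>. sets \<mu> = sets borel \<and>
     (\<forall>i\<in>indices M. \<forall>B\<in>sets borel. B \<subseteq> cdom M i \<longrightarrow>
        emeasure \<mu> B =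
          (\<integral>\<^sup>+ y\<in>coord M i ` B. ennreal (sqrt (gram_det M i (param M i y))) \<partial>lborel)))"

definition vector_field :: "('i, 'a, 'e::euclidean_space) rmfd \<Rightarrow> ('i \<Rightarrow> 'a \<Rightarrow> 'e) \<Rightarrow> bool" where
  "vector_field M W \<longleftrightarrow>
     (\<forall>q. \<forall>i\<in>charts_at M q. \<forall>j\<in>charts_at M q. W j q = transition_deriv M i j q (W i q))"

definition vnorm :: "('i, 'a, 'e) rmfd \<Rightarrow> ('i \<Rightarrow> 'a \<Rightarrow> 'e) \<Rightarrow> 'a \<Rightarrow> real" where
  "vnorm M W q = (let i = chart_at M q in sqrt (metric M i q (W i q) (W i q)))"

definition gradient ::
  "('i, 'a, 'e::euclidean_space) rmfd \<Rightarrow> ('a \<Rightarrow> real) \<Rightarrow> 'i \<Rightarrow> 'a \<Rightarrow> 'e" where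
  "gradient M u i q =
     (THE w. \<forall>v. metric M i q w v = frechet_derivative (u \<circ> param M i) (at (coord M i q)) v)"

definition smooth_compact_support ::
  "('i, 'a::topological_space, 'e::euclidean_space) rmfd \<Rightarrow> ('a \<Rightarrow> real) \<Rightarrow> bool" where
  "smooth_compact_support M u \<longleftrightarrow>
     (\<forall>i\<in>indices M. smooth_on (coord M i ` cdom M i) (u \<circ> param M i)) \<and>
     (\<exists>K. compact K \<and> (\<forall>q. q \<notin> K \<longrightarrow> u q = 0))"

text \<open>
  \<open>W\<close> is the weak gradient of \<open>u\<close>: in each chart the components \<open>g(W, v)\<close> of its dual covector field
  are the weak partial derivatives of \<open>u\<close>.
\<close>

definition weak_gradient ::
  "('i, 'a, 'e::euclidean_space) rmfd \<Rightarrow> ('a \<Rightarrow> real) \<Rightarrow> ('i \<Rightarrow> 'a \<Rightarrow> 'e) \<Rightarrow> bool" where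
  "weak_gradient M u W \<longleftrightarrow>
     (\<forall>i\<in>indices M. \<forall>v. \<forall>\<psi> K.
        smooth_on UNIV \<psi> \<and> compact K \<and> K \<subseteq> coord M i ` cdom M i \<and> (\<forall>y. y \<notin> K \<longrightarrow> \<psi> y = 0) \<longrightarrow>
        (LINT y|lborel. u (param M i y) * frechet_derivative \<psi> (at y) v) =
        - (LINT y|lborel. metric M i (param M i y) (W i (param M i y)) v * \<psi> y))"

text \<open>\<open>u\<close> lies in \<open>W\<^sup>1\<^sup>,\<^sup>p\<close> and has weak gradient \<open>W\<close>.\<close>

definition sobolev ::
  "('i, 'a::topological_space, real^'n) rmfd \<Rightarrow> real \<Rightarrow> ('a \<Rightarrow> real) \<Rightarrow>
   ('i \<Rightarrow> 'a \<Rightarrow> real^'n) \<Rightarrow> bool" where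
  "sobolev M p u W \<longleftrightarrow>
     u \<in> borel_measurable borel \<and> integrable (volume M) (\<lambda>q. \<bar>u q\<bar> powr p) \<and>
     vector_field M W \<and>
     (\<forall>i\<in>indices M. (\<lambda>q. indicator (cdom M i) q *\<^sub>R W i q) \<in> borel_measurable borel) \<and>
     integrable (volume M) (\<lambda>q. vnorm M W q powr p) \<and>
     weak_gradient M u W"

text \<open>\<open>W\<^sub>0\<^sup>1\<^sup>,\<^sup>p\<close> is the closure of the smooth functions with compact support in \<open>W\<^sup>1\<^sup>,\<^sup>p\<close>.\<close>

definition sobolev0 ::
  "('i, 'a::topological_space, real^'n) rmfd \<Rightarrow> real \<Rightarrow> ('a \<Rightarrow> real) \<Rightarrow>
   ('i \<Rightarrow> 'a \<Rightarrow> real^'n) \<Rightarrow> bool" where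
  "sobolev0 M p u W \<longleftrightarrow>
     sobolev M p u W \<and>
     (\<exists>\<phi> :: nat \<Rightarrow> 'a \<Rightarrow> real.
        (\<forall>k. smooth_compact_support M (\<phi> k)) \<and>
        (\<lambda>k. LINT q|volume M. \<bar>u q - \<phi> k q\<bar> powr p) \<longlonglongrightarrow> 0 \<and>
        (\<lambda>k. LINT q|volume M. vnorm M (\<lambda>i q. W i q - gradient M (\<phi> k) i q) q powr p) \<longlonglongrightarrow> 0)"

definition first_eigenvalue ::
  "('i, 'a::topological_space, real^'n) rmfd \<Rightarrow> real \<Rightarrow> real" where
  "first_eigenvalue M p =
     Inf {(LINT q|volume M. vnorm M W q powr p) / (LINT q|volume M. \<bar>u q\<bar> powr p) | u W.
            sobolev0 M p u W \<and> \<not> (AE q in volume M. u q = 0)}"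


section \<open>Levi-Civita connection and hypersurfaces\<close>

text \<open>
  The connection form at \<open>q\<close> in chart \<open>i\<close> of the Levi-Civita connection, i.e. of the unique
  connection which is torsion-free (its form is symmetric) and compatible with the metric. In
  coordinates, the covariant derivative of \<open>Y\<close> along \<open>X\<close> is the directional derivative of \<open>Y\<close>
  along \<open>X\<close> plus \<open>levi_civita M i q X Y\<close>.
\<close>

definition levi_civita ::
  "('i, 'a, 'e::euclidean_space) rmfd \<Rightarrow> 'i \<Rightarrow> 'a \<Rightarrow> 'e \<Rightarrow> 'e \<Rightarrow> 'e" where
  "levi_civita M i q = (THE \<Gamma>.
     bilinear \<Gamma> \<and> (\<forall>v w. \<Gamma> v w = \<Gamma> w v) \<and>
     (\<forall>z v w. frechet_derivative (\<lambda>y. metric M i (param M i y) v w) (at (coord M i q)) z =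
        metric M i q (\<Gamma> z v) w + metric M i q v (\<Gamma> z w)))"

text \<open>In the following, \<open>S\<close> is the source and \<open>T\<close> the target (ambient) manifold of a map \<open>x\<close>.\<close>

definition smooth_map ::
  "('j, 's::topological_space, 'd::euclidean_space) rmfd \<Rightarrow>
   ('i, 'a::topological_space, 'e::euclidean_space) rmfd \<Rightarrow> ('s \<Rightarrow> 'a) \<Rightarrow> bool" where
  "smooth_map S T x \<longleftrightarrow>
     continuous_on UNIV x \<and>
     (\<forall>j\<in>indices S. \<forall>i\<in>indices T.
        smooth_on (coord S j ` (cdom S j \<inter> x -` cdom T i)) (coord T i \<circ> x \<circ> param S j))"

definition differential ::
  "('j, 's, 'd::euclidean_space) rmfd \<Rightarrow> ('i, 'a, 'e::euclidean_space) rmfd \<Rightarrow> ('s \<Rightarrow> 'a) \<Rightarrow>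
   'j \<Rightarrow> 'i \<Rightarrow> 's \<Rightarrow> 'd \<Rightarrow> 'e" where
  "differential S T x j i q =
     frechet_derivative (coord T i \<circ> x \<circ> param S j) (at (coord S j q))"

definition isometric_immersion ::
  "('j, 's::topological_space, 'd::euclidean_space) rmfd \<Rightarrow>
   ('i, 'a::topological_space, 'e::euclidean_space) rmfd \<Rightarrow> ('s \<Rightarrow> 'a) \<Rightarrow> bool" where
  "isometric_immersion S T x \<longleftrightarrow>
     smooth_map S T x \<and>
     (\<forall>q. \<forall>j\<in>charts_at S q. \<forall>i\<in>charts_at T (x q).
        inj (differential S T x j i q) \<and>
        (\<forall>v w. metric S j q v w =
           metric T i (x q) (differential S T x j i q v) (differential S T x j i q w)))"

text \<open>
  A vector field along \<open>x\<close>, tangent to the ambient manifold: \<open>N i q\<close> are the coordinates of its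
  value at \<open>q\<close> with respect to the ambient chart \<open>i\<close> around \<open>x q\<close>.
\<close>

definition smooth_field_along ::
  "('j, 's, 'd::euclidean_space) rmfd \<Rightarrow> ('i, 'a, 'e::euclidean_space) rmfd \<Rightarrow> ('s \<Rightarrow> 'a) \<Rightarrow>
   ('i \<Rightarrow> 's \<Rightarrow> 'e) \<Rightarrow> bool" where
  "smooth_field_along S T x N \<longleftrightarrow>
     (\<forall>q. \<forall>i\<in>charts_at T (x q). \<forall>k\<in>charts_at T (x q).
        N k q = transition_deriv T i k (x q) (N i q)) \<and>
     (\<forall>j\<in>indices S. \<forall>i\<in>indices T.
        smooth_on (coord S j ` (cdom S j \<inter> x -` cdom T i)) (N i \<circ> param S j))"

definition unit_normal_field ::
  "('j, 's, 'd::euclidean_space) rmfd \<Rightarrow> ('i, 'a, 'e::euclidean_space) rmfd \<Rightarrow> ('s \<Rightarrow> 'a) \<Rightarrow>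
   ('i \<Rightarrow> 's \<Rightarrow> 'e) \<Rightarrow> bool" where
  "unit_normal_field S T x N \<longleftrightarrow>
     smooth_field_along S T x N \<and>
     (\<forall>q. \<forall>j\<in>charts_at S q. \<forall>i\<in>charts_at T (x q).
        metric T i (x q) (N i q) (N i q) = 1 \<and>
        (\<forall>v. metric T i (x q) (N i q) (differential S T x j i q v) = 0))"

text \<open>The covariant derivative along \<open>x\<close> of the field \<open>N\<close> in the direction \<open>v\<close>.\<close>

definition cov_deriv_along ::
  "('j, 's, 'd::euclidean_space) rmfd \<Rightarrow> ('i, 'a, 'e::euclidean_space) rmfd \<Rightarrow> ('s \<Rightarrow> 'a) \<Rightarrow>
   ('i \<Rightarrow> 's \<Rightarrow> 'e) \<Rightarrow> 'j \<Rightarrow> 'i \<Rightarrow> 's \<Rightarrow> 'd \<Rightarrow> 'e" where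
  "cov_deriv_along S T x N j i q v =
     frechet_derivative (N i \<circ> param S j) (at (coord S j q)) v +
     levi_civita T i (x q) (differential S T x j i q v) (N i q)"

definition shape_operator ::
  "('j, 's, 'd::euclidean_space) rmfd \<Rightarrow> ('i, 'a, 'e::euclidean_space) rmfd \<Rightarrow> ('s \<Rightarrow> 'a) \<Rightarrow>
   ('i \<Rightarrow> 's \<Rightarrow> 'e) \<Rightarrow> 'j \<Rightarrow> 's \<Rightarrow> 'd \<Rightarrow> 'd" where
  "shape_operator S T x N j q v =
     (THE w. \<forall>i\<in>charts_at T (x q).
        differential S T x j i q w = - cov_deriv_along S T x N j i q v)"

definition mean_curvature ::
  "('j, 's, real^'n) rmfd \<Rightarrow> ('i, 'a, 'e::euclidean_space) rmfd \<Rightarrow> ('s \<Rightarrow> 'a) \<Rightarrow>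
   ('i \<Rightarrow> 's \<Rightarrow> 'e) \<Rightarrow> 's \<Rightarrow> real" where
  "mean_curvature S T x N q =
     trace (matrix (shape_operator S T x N (chart_at S q) q)) / real CARD('n)"


section \<open>Pseudo-hyperbolic manifolds\<close>

definition pseudo_hyperbolic ::
  "('i, 'm, 'e::euclidean_space) rmfd \<Rightarrow> ('i, real \<times> 'm, real \<times> 'e) rmfd" where
  "pseudo_hyperbolic M =
     \<lparr>indices = indices M,
      cdom = (\<lambda>i. UNIV \<times> cdom M i),
      coord = (\<lambda>i (t, p). (t, coord M i p)),
      metric = (\<lambda>i (t, p) (a, v) (b, w). a * b + exp (2 * t) * metric M i p v w)\<rparr>"

text \<open>The coordinate field \<open>\<partial>\<^sub>t\<close> is \<open>(1, 0)\<close> in each of the above product charts.\<close>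

definition angle_function ::
  "('i, 'm, 'e::euclidean_space) rmfd \<Rightarrow> ('s \<Rightarrow> real \<times> 'm) \<Rightarrow> ('i \<Rightarrow> 's \<Rightarrow> real \<times> 'e) \<Rightarrow>
   's \<Rightarrow> real" where
  "angle_function M x N q =
     (let T = pseudo_hyperbolic M; i = chart_at T (x q) in metric T i (x q) (N i q) (1, 0))"

definition helix_type ::
  "('i, 'm, 'e::euclidean_space) rmfd \<Rightarrow> ('s \<Rightarrow> real \<times> 'm) \<Rightarrow> ('i \<Rightarrow> 's \<Rightarrow> real \<times> 'e) \<Rightarrow>
   bool" where
  "helix_type M x N \<longleftrightarrow> (\<exists>c. \<forall>q. angle_function M x N q = c)"

definition in_slab :: "('s \<Rightarrow> real \<times> 'm) \<Rightarrow> bool" where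
  "in_slab x \<longleftrightarrow> (\<exists>t1 t2. t1 < t2 \<and> range x \<subseteq> {t1..t2} \<times> UNIV)"

definition is_slice :: "('s \<Rightarrow> real \<times> 'm) \<Rightarrow> bool" where
  "is_slice x \<longleftrightarrow> (\<exists>t. range x = {t} \<times> UNIV)"

end

theory Submission
  imports Defs
begin

text \<open>
  Let \<open>\<theta>\<close> be the constant angle between the unit normal \<open>N\<close> and \<open>\<partial>\<^sub>t\<close>, and let \<open>h\<close> be the height function
  of the hypersurface, the first component of the immersion. The tangential part
  \<open>\<partial>\<^sub>t - \<theta> N\<close> of \<open>\<partial>\<^sub>t\<close> is the gradient of \<open>h\<close>, so \<open>\<bar>\<nabla>h\<bar>\<^sup>2 = 1 - \<theta>\<^sup>2\<close> is constant
  (\<open>height_gradient\<close>).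

  On a complete manifold a continuous function which is bounded below has points at which its
  slope is as small as desired (\<open>almost_critical_point\<close>). This is Ekeland's variational principle;
  applied to \<open>-h\<close>, which is bounded because of the slab, it excludes a gradient of constant
  positive length. So \<open>\<theta>\<^sup>2 = 1\<close>, the differential of \<open>h\<close> vanishes, and the hypersurface lies in one
  slice \<open>{t} \<times> M\<close>.

  It remains to see that it covers the whole slice. Its projection \<open>y\<close> to \<open>M\<close> scales all lengths by
  the factor \<open>exp (-t)\<close> and has invertible differentials. Given a point of \<open>M\<close> close to a point
  in the range of \<open>y\<close>, the distance from \<open>y q\<close> to it in a chart, cut off at a small radius, is again a
  continuous function of \<open>q\<close> to which \<open>almost_critical_point\<close> applies. Its slope is bounded below
  wherever it is positive and below the cutoff, so it vanishes somewhere, that is, \<open>y\<close> attains the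
  given point (\<open>surj_if_locally_expanding\<close>). The range of \<open>y\<close> is therefore open and closed, and all
  of \<open>M\<close> by connectedness. The variational principle thus replaces both the flow of \<open>\<nabla>h\<close> and
  the lifting of paths through \<open>y\<close>; all it needs are the elementary properties of the Riemannian
  distance, notably that it induces a topology at least as fine as the given one
  (\<open>riemannian_dist_small_imp_mem_open\<close>).
\<close>

section \<open>Smooth maps and curves in Euclidean space\<close>

lemma smooth_on_has_derivative:
  assumes "smooth_on U f" "y \<in> U"
  shows "(f has_derivative frechet_derivative f (at y)) (at y)"
  using assms(1)[unfolded smooth_on_def, rule_format, of "Suc 0"] assms(2)
  by (simp add: frechet_derivative_works)

lemma smooth_on_continuous_on: "smooth_on U f \<Longrightarrow> continuous_on U f"
  unfolding smooth_on_def by (metis times_differentiable_on.simps(1))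

text \<open>
  Smoothness provides continuity in \<open>y\<close> for each fixed direction \<open>v\<close>. Expanding \<open>v\<close> in the finite basis
  turns this into joint continuity, as needed for velocities which vary along a curve.
\<close>

lemma smooth_on_continuous_derivative:
  fixes f :: "'a::euclidean_space \<Rightarrow> 'b::euclidean_space"
  assumes "smooth_on U f"
  shows "continuous_on (U \<times> UNIV) (\<lambda>(y, v). frechet_derivative f (at y) v)"
proof -
  have c: "continuous_on U (\<lambda>y. frechet_derivative f (at y) v)" for v
    using assms[unfolded smooth_on_def, rule_format, of "Suc 0"] by simp
  have eq: "(\<lambda>(y, v). \<Sum>b\<in>Basis. (v \<bullet> b) *\<^sub>R frechet_derivative f (at y) b) z =
      (\<lambda>(y, v). frechet_derivative f (at y) v) z" if z_in: "z \<in> U \<times> UNIV" for z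
  proof -
    obtain y v where z: "z = (y, v)" "y \<in> U" using z_in by auto
    have lin: "linear (frechet_derivative f (at y))"
      using smooth_on_has_derivative[OF assms z(2)] by (rule has_derivative_linear)
    have "frechet_derivative f (at y) v = frechet_derivative f (at y) (\<Sum>b\<in>Basis. (v \<bullet> b) *\<^sub>R b)"
      by (simp add: euclidean_representation)
    then show ?thesis
      by (simp add: z linear_sum[OF lin] linear_cmul[OF lin])
  qed
  have "continuous_on (U \<times> UNIV) (\<lambda>(y, v). \<Sum>b\<in>Basis. (v \<bullet> b) *\<^sub>R frechet_derivative f (at y) b)"
    unfolding case_prod_beta
    by (intro continuous_on_sum continuous_on_scaleR continuous_on_inner continuous_on_const
        continuous_on_snd continuous_on_id continuous_on_compose2[OF c continuous_on_fst[OF continuous_on_id]]) auto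
  then show ?thesis
    by (rule continuous_on_eq) (rule eq)
qed

text \<open>
  The derivative may be unbounded near the exceptional points. If its norm has infinite integral,
  there is nothing to show; otherwise it is Lebesgue integrable, and the integral agrees with the
  Henstock-Kurzweil integral, for which the fundamental theorem of calculus allows finitely many
  exceptional points.
\<close>

lemma norm_increment_le_nn_integral:
  fixes g :: "real \<Rightarrow> 'e::euclidean_space"
  assumes "a \<le> b" and cont: "continuous_on {a..b} g" and "finite F"
    and deriv: "\<And>t. t \<in> {a..b} - F \<Longrightarrow> (g has_vector_derivative D t) (at t)"
    and contD: "continuous_on ({a..b} - F) D"
  shows "ennreal (norm (g b - g a)) \<le> (\<integral>\<^sup>+t\<in>{a..b}. ennreal (norm (D t)) \<partial>lborel)"
proof (cases "(\<integral>\<^sup>+t\<in>{a..b}. ennreal (norm (D t)) \<partial>lborel) < \<infinity>")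
  case True
  define E where "E t = indicator ({a..b} - F) t *\<^sub>R D t" for t
  have "closed F" using \<open>finite F\<close> by (rule finite_imp_closed)
  then have meas: "E \<in> borel_measurable borel"
    unfolding E_def
    by (intro borel_measurable_continuous_on_indicator[OF _ contD]) (auto intro: borel_closed)
  have le: "(\<integral>\<^sup>+t. ennreal (norm (E t)) \<partial>lborel) \<le> (\<integral>\<^sup>+t\<in>{a..b}. ennreal (norm (D t)) \<partial>lborel)"
    by (intro nn_integral_mono) (auto simp: E_def indicator_def)
  then have "integrable lborel E"
    using True meas by (intro integrableI_bounded) auto
  note int = has_integral_integral_lborel[OF this] integral_norm_bound_ennreal[OF this]
  have "(D has_integral (g b - g a)) {a..b}"
    using \<open>a \<le> b\<close> \<open>finite F\<close> cont deriv
    by (intro fundamental_theorem_of_calculus_strong[of F]) (auto intro: has_vector_derivative_at_within)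
  then have "((\<lambda>t. if t \<in> {a..b} then D t else 0) has_integral (g b - g a)) UNIV"
    by (simp only: has_integral_restrict_UNIV)
  then have "(E has_integral (g b - g a)) UNIV"
    by (rule has_integral_spike_finite[OF \<open>finite F\<close>, rotated]) (auto simp: E_def)
  then have "g b - g a = integral\<^sup>L lborel E"
    using int(1) has_integral_unique by blast
  then show ?thesis
    using int(2) le by simp
next
  case False
  then have "(\<integral>\<^sup>+t\<in>{a..b}. ennreal (norm (D t)) \<partial>lborel) = top"
    unfolding infinity_ennreal_def by (simp only: top.not_eq_extremum[symmetric] not_not)
  then show ?thesis by (simp only: top_greatest)
qed

section \<open>Slow descent in complete metric spaces\<close>

text \<open>
  The variational principle of Ekeland, in the form given by Caristi: call \<open>r\<close> reachable from \<open>q\<close> if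
  the decrease from \<open>f q\<close> to \<open>f r\<close> pays for the distance \<open>d q r\<close>. Moving repeatedly to a reachable point
  whose value is nearly the least reachable one gives a Cauchy sequence, since the total decrease is
  finite. Its limit is reachable from every member of the sequence, so nothing lower is reachable from
  the limit. The distance takes extended values because a Riemannian distance does so a priori.
\<close>

lemma caristi:
  fixes d :: "'a \<Rightarrow> 'a \<Rightarrow> ennreal" and f :: "'a \<Rightarrow> real"
  assumes refl: "\<And>a. d a a = 0" and sym: "\<And>a b. d a b = d b a"
    and triangle: "\<And>a b c. d a c \<le> d a b + d b c"
    and complete: "\<And>X :: nat \<Rightarrow> 'a. (\<forall>e>0. \<exists>K. \<forall>m\<ge>K. \<forall>n\<ge>K. d (X m) (X n) < e) \<Longrightarrow>
        \<exists>a. \<forall>e>0. \<exists>K. \<forall>n\<ge>K. d (X n) a < e"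
    and cont: "\<And>X a. \<forall>e>0. \<exists>K. \<forall>n\<ge>K. d (X n) a < e \<Longrightarrow> (\<lambda>n::nat. f (X n)) \<longlonglongrightarrow> f a"
    and bounded: "\<And>q. l \<le> f q" and "C > 0"
  shows "\<exists>a. f a \<le> f q0 \<and> (\<forall>q. f q < f a \<longrightarrow> \<not> d a q \<le> ennreal (C * (f a - f q)))"
proof -
  define R where "R q r \<longleftrightarrow> f r \<le> f q \<and> d q r \<le> ennreal (C * (f q - f r))" for q r
  have R_refl: "R q q" for q by (simp add: R_def refl)
  have R_trans: "R q s" if "R q r" "R r s" for q r s
  proof -
    have "d q s \<le> ennreal (C * (f q - f r)) + ennreal (C * (f r - f s))"
      using that triangle[of q s r] by (meson R_def add_mono order_trans)
    also have "\<dots> = ennreal (C * (f q - f r) + C * (f r - f s))"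
      using that \<open>C > 0\<close> by (intro ennreal_plus[symmetric]) (auto simp: R_def)
    finally show ?thesis using that by (auto simp: R_def algebra_simps)
  qed
  have ex: "\<exists>r. R q r \<and> (\<forall>s. R q s \<longrightarrow> f r \<le> f s + (1/2)^n)" for q and n :: nat
  proof -
    have bdd: "bdd_below (f ` {r. R q r})" using bounded by (intro bdd_belowI[of _ l]) auto
    have "Inf (f ` {r. R q r}) < Inf (f ` {r. R q r}) + (1/2)^n" by simp
    then obtain r where r: "R q r" "f r < Inf (f ` {r. R q r}) + (1/2)^n"
      using cInf_lessD[of "f ` {r. R q r}"] R_refl by blast
    moreover have "Inf (f ` {r. R q r}) \<le> f s" if "R q s" for s
      using that bdd by (auto intro: cInf_lower)
    ultimately show ?thesis by fastforce
  qed
  define nxt where "nxt n q = (SOME r. R q r \<and> (\<forall>s. R q s \<longrightarrow> f r \<le> f s + (1/2)^n))" for n :: nat and q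
  have nxt: "R q (nxt n q) \<and> (\<forall>s. R q s \<longrightarrow> f (nxt n q) \<le> f s + (1/2)^n)" for n q
    unfolding nxt_def using ex by (rule someI_ex)
  define X where "X = rec_nat q0 nxt"
  have X0: "X 0 = q0" and
    X: "R (X n) (X (Suc n)) \<and> (\<forall>s. R (X n) s \<longrightarrow> f (X (Suc n)) \<le> f s + (1/2)^n)" for n
    using nxt by (auto simp: X_def)
  have RX: "R (X m) (X n)" if "m \<le> n" for m n
    using that by (induction rule: dec_induct) (use R_refl R_trans X in blast)+
  have "decseq (\<lambda>n. f (X n))"
    using RX by (auto simp: decseq_def R_def)
  then have "Cauchy (\<lambda>n. f (X n))"
    using decseq_convergent[of "\<lambda>n. f (X n)" l] bounded LIMSEQ_imp_Cauchy by metis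
  have cauchy: "\<exists>K. \<forall>m\<ge>K. \<forall>n\<ge>K. d (X m) (X n) < e" if "e > 0" for e
  proof -
    obtain e' where e': "0 < e'" "e' < e" using dense[OF \<open>e > 0\<close>] by blast
    then have fin: "e' < top" using less_top_ennreal order_less_le_trans by (metis top_greatest)
    define \<epsilon> where "\<epsilon> = enn2real e'"
    have \<epsilon>: "\<epsilon> > 0" "ennreal \<epsilon> = e'" using e' fin by (auto simp: \<epsilon>_def enn2real_positive_iff)
    obtain K where K: "\<And>m n. m \<ge> K \<Longrightarrow> n \<ge> K \<Longrightarrow> dist (f (X m)) (f (X n)) < \<epsilon> / C"
      using \<open>Cauchy (\<lambda>n. f (X n))\<close> \<epsilon> \<open>C > 0\<close> unfolding Cauchy_def by (meson divide_pos_pos)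
    have *: "d (X m) (X n) < e" if "m \<ge> K" "n \<ge> K" "m \<le> n" for m n
    proof -
      have "C * (f (X m) - f (X n)) \<le> \<epsilon>"
        using K[OF that(1,2)] \<open>C > 0\<close> by (simp add: dist_real_def field_simps abs_less_iff)
      then have "d (X m) (X n) \<le> ennreal \<epsilon>"
        using RX[OF that(3)] by (meson R_def ennreal_leI order_trans)
      then show ?thesis using \<epsilon> e' by (simp add: order_le_less_trans)
    qed
    then show ?thesis by (metis linear sym)
  qed
  then obtain a where a: "\<forall>e>0. \<exists>K. \<forall>n\<ge>K. d (X n) a < e"
    using complete[of X] by blast
  note lim = cont[OF a]
  have fa: "f a \<le> f (X n)" for n
    using decseq_ge[OF \<open>decseq _\<close> lim] .
  have Ra: "R (X n) a" for n
  proof -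
    have "d (X n) a \<le> ennreal (C * (f (X n) - f a))"
    proof (rule ennreal_le_epsilon)
      fix e :: real assume "0 < e"
      then obtain K where "\<And>n. n \<ge> K \<Longrightarrow> d (X n) a < ennreal e" using a by (meson ennreal_less_zero_iff)
      then have m: "d (X (max n K)) a < ennreal e" by simp
      have "d (X n) a \<le> d (X n) (X (max n K)) + d (X (max n K)) a" by (rule triangle)
      also have "d (X n) (X (max n K)) \<le> ennreal (C * (f (X n) - f (X (max n K))))"
        using RX[of n "max n K"] by (simp add: R_def)
      also have "\<dots> \<le> ennreal (C * (f (X n) - f a))"
        using fa \<open>C > 0\<close> by (intro ennreal_leI) simp
      finally show "d (X n) a \<le> ennreal (C * (f (X n) - f a)) + ennreal e"
        using m by (simp add: add_mono order_trans[OF _ add_mono] less_imp_le)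
    qed
    then show ?thesis using fa by (simp add: R_def)
  qed
  have "\<not> d a q \<le> ennreal (C * (f a - f q))" if "f q < f a" for q
  proof
    assume "d a q \<le> ennreal (C * (f a - f q))"
    then have "R a q" using that by (simp add: R_def)
    then have "f (X (Suc n)) \<le> f q + (1/2)^n" for n
      using X[of n] R_trans[OF Ra[of n]] by blast
    moreover have "(\<lambda>n. f q + (1/2)^n) \<longlonglongrightarrow> f q + 0"
      by (intro tendsto_intros LIMSEQ_power_zero) auto
    ultimately have "f a \<le> f q"
      using LIMSEQ_le[OF LIMSEQ_Suc[OF lim]] by auto
    then show False using that by simp
  qed
  then show ?thesis using fa[of 0] X0 by auto
qed

section \<open>Gluing and reparametrizing curves\<close>

lemma C1_differentiable_on_cong_open:
  assumes "f C1_differentiable_on A" "open U" "A \<subseteq> U" "\<And>t. t \<in> U \<Longrightarrow> f t = g t"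
  shows "g C1_differentiable_on A"
proof -
  obtain D where "\<And>t. t \<in> A \<Longrightarrow> (f has_vector_derivative D t) (at t)" "continuous_on A D"
    using assms(1) by (auto simp: C1_differentiable_on_def)
  then show ?thesis
    unfolding C1_differentiable_on_def
    using has_vector_derivative_transform_within_open[OF _ assms(2), of f _ _ g] assms(3,4) by blast
qed

lemma C1_differentiable_on_compose_affine:
  fixes f :: "real \<Rightarrow> 'e::real_normed_vector"
  assumes "f C1_differentiable_on A"
  shows "(\<lambda>t. f (a * t + b)) C1_differentiable_on ((\<lambda>t. a * t + b) -` A)"
proof -
  obtain D where D: "\<And>t. t \<in> A \<Longrightarrow> (f has_vector_derivative D t) (at t)" "continuous_on A D"
    using assms by (auto simp: C1_differentiable_on_def)
  have "((\<lambda>t. f (a * t + b)) has_vector_derivative a *\<^sub>R D (a * t + b)) (at t)" if "a * t + b \<in> A" for t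
    by (rule vector_diff_chain_at[of "\<lambda>t. a * t + b" a _ f, unfolded o_def])
       (use D that in \<open>auto intro!: derivative_eq_intros simp: has_real_derivative_iff_has_vector_derivative[symmetric]\<close>)
  moreover have "continuous_on ((\<lambda>t. a * t + b) -` A) (\<lambda>t. a *\<^sub>R D (a * t + b))"
    by (intro continuous_on_scaleR continuous_on_const
        continuous_on_compose2[OF D(2), where f = "\<lambda>t. a * t + b"])
      (auto intro!: continuous_intros)
  ultimately show ?thesis
    unfolding C1_differentiable_on_def by (intro exI[of _ "\<lambda>t. a *\<^sub>R D (a * t + b)"]) auto
qed

lemma C1_differentiable_on_Un_open:
  assumes "f C1_differentiable_on (A \<inter> U)" "f C1_differentiable_on (A \<inter> V)"
    "open U" "open V" "A \<subseteq> U \<union> V"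
  shows "f C1_differentiable_on A"
proof -
  have A: "A \<inter> U \<union> A \<inter> V = A" using assms(5) by blast
  have "openin (top_of_set (A \<inter> U \<union> A \<inter> V)) (A \<inter> U)" "openin (top_of_set (A \<inter> U \<union> A \<inter> V)) (A \<inter> V)"
    using assms(3,4) by (auto simp: A openin_open)
  then have "continuous_on (A \<inter> U \<union> A \<inter> V) (\<lambda>t. vector_derivative f (at t))"
    using assms(1,2) by (intro continuous_on_Un_local_open) (auto simp: C1_differentiable_on_eq)
  moreover have "f differentiable at t" if "t \<in> A" for t
    using that assms(1,2,5) by (auto simp: C1_differentiable_on_eq)
  ultimately show ?thesis by (simp add: C1_differentiable_on_eq A)
qed

lemma nn_integral_lborel_cong_finite:
  fixes f g :: "real \<Rightarrow> ennreal"
  assumes "finite F" "\<And>t. t \<notin> F \<Longrightarrow> f t = g t"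
  shows "(\<integral>\<^sup>+t. f t \<partial>lborel) = (\<integral>\<^sup>+t. g t \<partial>lborel)"
proof (rule nn_integral_cong_AE)
  have "AE t in lborel. t \<notin> F"
    using finite_imp_null_set_lborel[OF assms(1)] by (rule AE_not_in)
  then show "AE t in lborel. f t = g t" by eventually_elim (rule assms(2))
qed

section \<open>Charts of a Riemannian manifold\<close>

text \<open>
  A piecewise \<open>C\<^sup>1\<close> curve with a chosen set \<open>F\<close> of exceptional times. The end points belong to \<open>F\<close>, so
  that \<open>{0..1} - F\<close> is open and the curve is continuous, in the two-sided sense, at all other times.
\<close>

definition C1_curve_off ::
  "('i, 'a::topological_space, 'e::euclidean_space) rmfd \<Rightarrow> real set \<Rightarrow> (real \<Rightarrow> 'a) \<Rightarrow> bool" where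
  "C1_curve_off S F \<gamma> \<longleftrightarrow> finite F \<and> {0, 1} \<subseteq> F \<and> continuous_on {0..1} \<gamma> \<and>
     (\<forall>i\<in>indices S. (coord S i \<circ> \<gamma>) C1_differentiable_on (({0..1} - F) \<inter> \<gamma> -` cdom S i))"

text \<open>
  Outside \<open>{0..1} - F\<close> the speed is arbitrary and possibly not measurable; setting it to zero there
  does not change the length, and makes the rules for Lebesgue integrals applicable.
\<close>

definition speed_off ::
  "('i, 'a, 'e::euclidean_space) rmfd \<Rightarrow> real set \<Rightarrow> (real \<Rightarrow> 'a) \<Rightarrow> real \<Rightarrow> ennreal" where
  "speed_off S F \<gamma> t = ennreal (indicator ({0..1} - F) t *\<^sub>R speed S \<gamma> t)"

context
  fixes S :: "('j, 's::{t2_space, second_countable_topology}, 'e::euclidean_space) rmfd"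
  assumes riemannian: "riemannian_manifold S"
begin

lemma smooth: "smooth_manifold S" and riem_metric: "riemannian_metric S"
  using riemannian by (auto simp: riemannian_manifold_def)

lemma open_cdom: "i \<in> indices S \<Longrightarrow> open (cdom S i)"
  using smooth by (simp add: smooth_manifold_def)

lemma open_coord_cdom: "i \<in> indices S \<Longrightarrow> open (coord S i ` cdom S i)"
  using smooth by (simp add: smooth_manifold_def)

lemma chart_homeomorphism:
  "i \<in> indices S \<Longrightarrow> homeomorphism (cdom S i) (coord S i ` cdom S i) (coord S i) (param S i)"
  using smooth by (simp add: smooth_manifold_def)

lemma param_coord: "i \<in> indices S \<Longrightarrow> q \<in> cdom S i \<Longrightarrow> param S i (coord S i q) = q"
  using chart_homeomorphism by (metis homeomorphism_apply1)

lemma coord_param: "i \<in> indices S \<Longrightarrow> y \<in> coord S i ` cdom S i \<Longrightarrow> coord S i (param S i y) = y"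
  using chart_homeomorphism by (metis homeomorphism_apply2)

lemma param_in_cdom: "i \<in> indices S \<Longrightarrow> y \<in> coord S i ` cdom S i \<Longrightarrow> param S i y \<in> cdom S i"
  using chart_homeomorphism by (metis homeomorphism_image2 imageI)

lemma continuous_on_coord: "i \<in> indices S \<Longrightarrow> continuous_on (cdom S i) (coord S i)"
  using chart_homeomorphism homeomorphism_cont1 by blast

lemma continuous_on_param: "i \<in> indices S \<Longrightarrow> continuous_on (coord S i ` cdom S i) (param S i)"
  using chart_homeomorphism homeomorphism_cont2 by blast

lemma open_coord_image:
  assumes "i \<in> indices S" "open V" "V \<subseteq> cdom S i"
  shows "open (coord S i ` V)"
proof -
  have "openin (top_of_set (coord S i ` cdom S i)) (coord S i ` V)"
    using homeomorphism_imp_open_map[OF chart_homeomorphism[OF assms(1)]] assms open_subset by blast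
  then show ?thesis using open_coord_cdom[OF assms(1)] openin_open_eq by blast
qed

lemma open_param_image:
  assumes "i \<in> indices S" "open V" "V \<subseteq> coord S i ` cdom S i"
  shows "open (param S i ` V)"
proof -
  have "openin (top_of_set (cdom S i)) (param S i ` V)"
    using homeomorphism_imp_open_map[OF homeomorphism_symD[OF chart_homeomorphism[OF assms(1)]]]
      assms open_subset by blast
  then show ?thesis using open_cdom[OF assms(1)] openin_open_eq by blast
qed

lemma chart_at: "chart_at S q \<in> charts_at S q"
proof -
  have "q \<in> (\<Union>i\<in>indices S. cdom S i)" using smooth by (simp add: smooth_manifold_def)
  then have "\<exists>i. i \<in> charts_at S q" by (auto simp: charts_at_def)
  then show ?thesis unfolding chart_at_def by (rule someI_ex)
qed

lemma smooth_transition: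
  assumes "i \<in> indices S" "j \<in> indices S"
  shows "smooth_on (coord S i ` (cdom S i \<inter> cdom S j)) (coord S j \<circ> param S i)"
  using smooth assms by (simp add: smooth_manifold_def)

lemma transition_has_derivative:
  assumes "i \<in> charts_at S q" "j \<in> charts_at S q"
  shows "((coord S j \<circ> param S i) has_derivative transition_deriv S i j q) (at (coord S i q))"
  unfolding transition_deriv_def
  by (rule smooth_on_has_derivative[OF smooth_transition[of i j]]) (use assms in \<open>auto simp: charts_at_def\<close>)

lemma bilinear_metric: "i \<in> charts_at S q \<Longrightarrow> bilinear (metric S i q)"
  using riem_metric unfolding riemannian_metric_def by blast

lemma metric_pos: "i \<in> charts_at S q \<Longrightarrow> v \<noteq> 0 \<Longrightarrow> metric S i q v v > 0"
  using riem_metric unfolding riemannian_metric_def by blast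

lemma metric_zero: "i \<in> charts_at S q \<Longrightarrow> metric S i q 0 0 = 0"
  using bilinear_metric bilinear_lzero by blast

lemma metric_nonneg: "i \<in> charts_at S q \<Longrightarrow> metric S i q v v \<ge> 0"
  using metric_pos metric_zero by (cases "v = 0") (auto intro: less_imp_le)

lemma metric_scaleR:
  assumes "i \<in> charts_at S q"
  shows "metric S i q (a *\<^sub>R v) (a *\<^sub>R v) = a\<^sup>2 * metric S i q v v"
  using bilinear_lmul[OF bilinear_metric[OF assms], of a v] bilinear_rmul[OF bilinear_metric[OF assms], of _ a v]
  by (simp add: power2_eq_square)

lemma metric_transition:
  assumes "i \<in> charts_at S q" "j \<in> charts_at S q"
  shows "metric S j q (transition_deriv S i j q v) (transition_deriv S i j q w) = metric S i q v w"
  using riem_metric assms unfolding riemannian_metric_def by metis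

lemma charts_at_param:
  "i \<in> indices S \<Longrightarrow> y \<in> coord S i ` cdom S i \<Longrightarrow> i \<in> charts_at S (param S i y)"
  by (simp add: charts_at_def param_in_cdom)

text \<open>
  As for derivatives, joint continuity follows from that of the finitely many components.
\<close>

lemma continuous_on_metric:
  assumes i: "i \<in> indices S"
  shows "continuous_on (coord S i ` cdom S i \<times> UNIV) (\<lambda>(y, v). metric S i (param S i y) v v)"
proof -
  let ?g = "\<lambda>y. metric S i (param S i y)"
  have c: "continuous_on (coord S i ` cdom S i) (\<lambda>y. ?g y b b')" for b b'
    using riem_metric i unfolding riemannian_metric_def
    by (intro smooth_on_continuous_on) blast
  have eq: "(\<lambda>(y, v). \<Sum>b\<in>Basis. \<Sum>b'\<in>Basis. (v \<bullet> b) * ((v \<bullet> b') * ?g y b' b)) z =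
      (\<lambda>(y, v). ?g y v v) z" if z_in: "z \<in> coord S i ` cdom S i \<times> UNIV" for z
  proof -
    obtain y v where z: "z = (y, v)" "y \<in> coord S i ` cdom S i" using z_in by blast
    have bil: "bilinear (?g y)" using charts_at_param[OF i z(2)] by (rule bilinear_metric)
    interpret l: linear "\<lambda>a. ?g y a b" for b using bil by (simp add: bilinear_def)
    interpret r: linear "\<lambda>b. ?g y a b" for a using bil by (simp add: bilinear_def)
    have "?g y v v = ?g y (\<Sum>b\<in>Basis. (v \<bullet> b) *\<^sub>R b) (\<Sum>b\<in>Basis. (v \<bullet> b) *\<^sub>R b)"
      by (simp add: euclidean_representation)
    then show ?thesis
      by (simp only: z prod.case l.sum l.scale r.sum r.scale real_scaleR_def sum_distrib_left)
  qed
  have "continuous_on (coord S i ` cdom S i \<times> UNIV)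
      (\<lambda>(y, v). \<Sum>b\<in>Basis. \<Sum>b'\<in>Basis. (v \<bullet> b) * ((v \<bullet> b') * ?g y b' b))"
    unfolding case_prod_beta
    by (intro continuous_on_sum continuous_on_mult continuous_on_inner continuous_on_const
        continuous_on_snd continuous_on_id continuous_on_compose2[OF c continuous_on_fst[OF continuous_on_id]]) auto
  then show ?thesis by (rule continuous_on_eq) (rule eq)
qed

lemma continuous_on_metric_compose:
  assumes "i \<in> indices S" "continuous_on A f" "continuous_on A g" "f ` A \<subseteq> coord S i ` cdom S i"
  shows "continuous_on A (\<lambda>t. metric S i (param S i (f t)) (g t) (g t))"
  using continuous_on_compose2[OF continuous_on_metric[OF assms(1)]
      continuous_on_Pair[OF assms(2,3)]] assms(4) by auto

section \<open>Speed and length of curves\<close>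

lemma speed_nonneg: "speed S \<gamma> t \<ge> 0"
  unfolding speed_def Let_def using metric_nonneg[OF chart_at] by simp

text \<open>
  The definition of the speed uses an arbitrary chart around each point. As the metric is
  compatible with the chart transitions, every chart gives the same value.
\<close>

lemma speed_eq:
  assumes i: "i \<in> charts_at S (\<gamma> t)" and cont: "isCont \<gamma> t"
    and v: "((coord S i \<circ> \<gamma>) has_vector_derivative v) (at t)"
  shows "speed S \<gamma> t = sqrt (metric S i (\<gamma> t) v v)"
proof -
  define k where "k = chart_at S (\<gamma> t)"
  have k: "k \<in> charts_at S (\<gamma> t)" unfolding k_def by (rule chart_at)
  have ik: "i \<in> indices S" "\<gamma> t \<in> cdom S i" using i by (auto simp: charts_at_def)
  have "\<forall>\<^sub>F s in at t. \<gamma> s \<in> cdom S i"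
    using cont open_cdom[OF ik(1)] ik(2) unfolding isCont_def by (rule topological_tendstoD)
  then have ev: "\<forall>\<^sub>F s in at t. (coord S k \<circ> \<gamma>) s = ((coord S k \<circ> param S i) \<circ> (coord S i \<circ> \<gamma>)) s"
    by eventually_elim (simp add: param_coord ik)
  have "((coord S k \<circ> param S i) has_derivative transition_deriv S i k (\<gamma> t)) (at ((coord S i \<circ> \<gamma>) t))"
    using transition_has_derivative[OF i k] by simp
  from vector_derivative_diff_chain_within[OF v has_derivative_at_withinI[OF this]]
  have "(((coord S k \<circ> param S i) \<circ> (coord S i \<circ> \<gamma>)) has_vector_derivative
      transition_deriv S i k (\<gamma> t) v) (at t)" .
  then have "((coord S k \<circ> \<gamma>) has_vector_derivative transition_deriv S i k (\<gamma> t) v) (at t)"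
    unfolding has_vector_derivative_def
    by (rule has_derivative_transform_eventually)
      (use ev in \<open>auto simp: eq_commute param_coord ik elim: eventually_mono\<close>)
  then have "vector_derivative (coord S k \<circ> \<gamma>) (at t) = transition_deriv S i k (\<gamma> t) v"
    by (rule vector_derivative_at)
  then show ?thesis
    using metric_transition[OF i k] by (simp add: speed_def k_def[symmetric])
qed

lemma piecewise_C1_curve_iff: "piecewise_C1_curve S \<gamma> \<longleftrightarrow> (\<exists>F. C1_curve_off S F \<gamma>)"
proof
  assume "piecewise_C1_curve S \<gamma>"
  then obtain F where F: "finite F" "continuous_on {0..1} \<gamma>"
    "\<forall>i\<in>indices S. (coord S i \<circ> \<gamma>) C1_differentiable_on (({0..1} - F) \<inter> \<gamma> -` cdom S i)"
    unfolding piecewise_C1_curve_def by blast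
  have "C1_curve_off S ({0, 1} \<union> F) \<gamma>"
    unfolding C1_curve_off_def using F by (auto intro: C1_differentiable_on_subset)
  then show "\<exists>F. C1_curve_off S F \<gamma>" ..
qed (auto simp: piecewise_C1_curve_def C1_curve_off_def)

lemma C1_curve_off_isCont:
  assumes "C1_curve_off S F \<gamma>" "t \<in> {0..1} - F"
  shows "isCont \<gamma> t"
proof -
  have "t \<in> {0<..<1}" using assms by (auto simp: C1_curve_off_def less_le)
  moreover have "continuous_on {0<..<1} \<gamma>"
    using assms(1) by (auto simp: C1_curve_off_def intro: continuous_on_subset)
  ultimately show ?thesis by (simp add: continuous_on_eq_continuous_at)
qed

lemma open_C1_points:
  assumes "C1_curve_off S F \<gamma>" shows "open ({0..1} - F)"
proof -
  have "{0..1} - F = {0<..<1} - F" using assms by (auto simp: C1_curve_off_def less_le)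
  then show ?thesis using assms by (auto simp: C1_curve_off_def intro: open_Diff finite_imp_closed)
qed

lemma open_chart_times:
  assumes "C1_curve_off S F \<gamma>" "open V"
  shows "open (({0..1} - F) \<inter> \<gamma> -` V)"
proof -
  have "continuous_on ({0..1} - F) \<gamma>"
    using assms(1) by (auto simp: C1_curve_off_def intro: continuous_on_subset)
  then show ?thesis
    using open_C1_points[OF assms(1)] assms(2)
    by (metis Int_commute continuous_on_open_vimage)
qed

lemma C1_curve_off_derivative:
  assumes "C1_curve_off S F \<gamma>" "t \<in> {0..1} - F" "i \<in> charts_at S (\<gamma> t)"
  shows "((coord S i \<circ> \<gamma>) has_vector_derivative vector_derivative (coord S i \<circ> \<gamma>) (at t)) (at t)"
    "speed S \<gamma> t = sqrt (metric S i (\<gamma> t) (vector_derivative (coord S i \<circ> \<gamma>) (at t))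
       (vector_derivative (coord S i \<circ> \<gamma>) (at t)))"
proof -
  have "(coord S i \<circ> \<gamma>) differentiable at t"
    using assms by (auto simp: C1_curve_off_def C1_differentiable_on_eq charts_at_def)
  then show 1: "((coord S i \<circ> \<gamma>) has_vector_derivative vector_derivative (coord S i \<circ> \<gamma>) (at t)) (at t)"
    using vector_derivative_works by blast
  show "speed S \<gamma> t = sqrt (metric S i (\<gamma> t) (vector_derivative (coord S i \<circ> \<gamma>) (at t))
       (vector_derivative (coord S i \<circ> \<gamma>) (at t)))"
    by (rule speed_eq[OF assms(3) C1_curve_off_isCont[OF assms(1,2)] 1])
qed

text \<open>
  The arbitrary charts in the definition of the speed vary with the time in an uncontrolled way, but near
  each time a single chart may be used.
\<close>

lemma continuous_on_speed:
  assumes \<gamma>: "C1_curve_off S F \<gamma>"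
  shows "continuous_on ({0..1} - F) (speed S \<gamma>)"
proof -
  have "isCont (speed S \<gamma>) t" if t: "t \<in> {0..1} - F" for t
  proof -
    define i where "i = chart_at S (\<gamma> t)"
    have i: "i \<in> indices S" "\<gamma> t \<in> cdom S i" using chart_at[of "\<gamma> t"] by (auto simp: i_def charts_at_def)
    define A where "A = ({0..1} - F) \<inter> \<gamma> -` cdom S i"
    define D where "D s = vector_derivative (coord S i \<circ> \<gamma>) (at s)" for s
    have "open A" unfolding A_def by (rule open_chart_times[OF \<gamma> open_cdom[OF i(1)]])
    have "t \<in> A" using t i by (simp add: A_def)
    have "continuous_on A D"
      unfolding D_def using \<gamma> i(1) by (auto simp: C1_curve_off_def C1_differentiable_on_eq A_def)
    moreover have "continuous_on A \<gamma>"
      using \<gamma> by (auto simp: C1_curve_off_def A_def intro: continuous_on_subset)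
    then have "continuous_on A (\<lambda>s. coord S i (\<gamma> s))"
      by (rule continuous_on_compose2[OF continuous_on_coord[OF i(1)]]) (auto simp: A_def)
    ultimately have "continuous_on A (\<lambda>s. metric S i (param S i (coord S i (\<gamma> s))) (D s) (D s))"
      by (intro continuous_on_metric_compose[OF i(1)]) (auto simp: A_def)
    then have "continuous_on A (\<lambda>s. sqrt (metric S i (param S i (coord S i (\<gamma> s))) (D s) (D s)))"
      by (rule continuous_on_real_sqrt)
    moreover have "sqrt (metric S i (param S i (coord S i (\<gamma> s))) (D s) (D s)) = speed S \<gamma> s" if "s \<in> A" for s
      using that i C1_curve_off_derivative(2)[OF \<gamma>, of s i]
      by (auto simp: A_def D_def param_coord charts_at_def)
    ultimately have "continuous_on A (speed S \<gamma>)" by (rule continuous_on_eq)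
    then show ?thesis using \<open>open A\<close> \<open>t \<in> A\<close> by (simp add: continuous_on_eq_continuous_at)
  qed
  then show ?thesis by (intro continuous_at_imp_continuous_on) auto
qed

lemma speed_off_measurable:
  assumes "C1_curve_off S F \<gamma>" shows "speed_off S F \<gamma> \<in> borel_measurable borel"
  unfolding speed_off_def
  by (intro measurable_compose[OF _ measurable_ennreal] borel_measurable_continuous_on_indicator
      continuous_on_speed[OF assms] borel_open open_C1_points[OF assms])

lemma curve_length_eq:
  assumes "C1_curve_off S F \<gamma>"
  shows "curve_length S \<gamma> = (\<integral>\<^sup>+t. speed_off S F \<gamma> t \<partial>lborel)"
  unfolding curve_length_def
  by (rule nn_integral_lborel_cong_finite[of F])
    (use assms in \<open>auto simp: C1_curve_off_def speed_off_def indicator_def\<close>)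

text \<open>
  The curve \<open>\<eta>\<close> need only be a reparametrization of \<open>\<gamma>\<close> near the time \<open>t\<close>. This covers reversed
  curves as well as both halves of joined curves.
\<close>

lemma speed_affine:
  assumes \<gamma>: "C1_curve_off S F \<gamma>" and t: "a * t + b \<in> {0..1} - F"
    and U: "open U" "t \<in> U" "\<And>s. s \<in> U \<Longrightarrow> \<eta> s = \<gamma> (a * s + b)"
  shows "speed S \<eta> t = \<bar>a\<bar> * speed S \<gamma> (a * t + b)"
proof -
  define i where "i = chart_at S (\<gamma> (a * t + b))"
  have i: "i \<in> charts_at S (\<gamma> (a * t + b))" unfolding i_def by (rule chart_at)
  define v where "v = vector_derivative (coord S i \<circ> \<gamma>) (at (a * t + b))"
  note d = C1_curve_off_derivative[OF \<gamma> t i, folded v_def]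
  have "((\<lambda>s. a * s + b) has_vector_derivative a) (at t)"
    by (auto intro!: derivative_eq_intros simp: has_real_derivative_iff_has_vector_derivative[symmetric])
  from vector_diff_chain_at[OF this d(1)]
  have "(coord S i \<circ> \<eta> has_vector_derivative a *\<^sub>R v) (at t)"
    by (rule has_vector_derivative_transform_within_open[OF _ U(1,2)]) (simp add: U(3))
  moreover have "isCont (\<lambda>s. \<gamma> (a * s + b)) t"
    by (rule isCont_o2[where f = "\<lambda>s. a * s + b" and g = \<gamma>, OF _ C1_curve_off_isCont[OF \<gamma> t]]) simp
  then have "isCont \<eta> t"
    using U by (subst isCont_cong[where g = "\<lambda>s. \<gamma> (a * s + b)"]) (auto simp: eventually_nhds)
  moreover have "\<eta> t = \<gamma> (a * t + b)" using U by simp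
  ultimately have "speed S \<eta> t = sqrt (metric S i (\<gamma> (a * t + b)) (a *\<^sub>R v) (a *\<^sub>R v))"
    using speed_eq[of i \<eta> t] i by simp
  then show ?thesis
    using d(2) by (simp add: metric_scaleR[OF i] real_sqrt_mult)
qed

lemma C1_affine:
  assumes \<gamma>: "C1_curve_off S F \<gamma>" and i: "i \<in> indices S"
    and U: "open U" "\<And>s. s \<in> U \<Longrightarrow> \<eta> s = \<gamma> (a * s + b)"
    and A: "A \<subseteq> U" "\<And>s. s \<in> A \<Longrightarrow> a * s + b \<in> {0..1} - F \<and> \<eta> s \<in> cdom S i"
  shows "(coord S i \<circ> \<eta>) C1_differentiable_on A"
proof -
  have "(coord S i \<circ> \<gamma>) C1_differentiable_on (({0..1} - F) \<inter> \<gamma> -` cdom S i)"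
    using \<gamma> i by (simp add: C1_curve_off_def)
  from C1_differentiable_on_compose_affine[OF this, of a b]
  have "(\<lambda>t. (coord S i \<circ> \<gamma>) (a * t + b)) C1_differentiable_on A"
    by (rule C1_differentiable_on_subset) (use A U in fastforce)
  then show ?thesis
    by (rule C1_differentiable_on_cong_open[OF _ U(1) A(1)]) (simp add: U(2))
qed

lemma reversed_curve:
  assumes "piecewise_C1_curve S \<gamma>"
  shows "piecewise_C1_curve S (reversepath \<gamma>)" "curve_length S (reversepath \<gamma>) = curve_length S \<gamma>"
proof -
  obtain F where F: "C1_curve_off S F \<gamma>" using assms piecewise_C1_curve_iff by blast
  define F' where "F' = (\<lambda>t. 1 - t) ` F"
  have F': "1 - t \<in> {0..1} - F" if "t \<in> {0..1} - F'" for t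
    using that by (auto simp: F'_def image_iff)
  have F'': "t \<in> {0..1} - F'" if "1 - t \<in> {0..1} - F" for t
    using that by (auto simp: F'_def)
  have rev: "reversepath \<gamma> s = \<gamma> (-1 * s + 1)" for s by (simp add: reversepath_def)
  have "continuous_on {0..1} (reversepath \<gamma>)"
    using F unfolding reversepath_def C1_curve_off_def
    by (intro continuous_on_compose2[where g = \<gamma> and f = "\<lambda>s. 1 - s" and t = "{0..1}"])
      (auto intro!: continuous_intros)
  moreover have "(coord S i \<circ> reversepath \<gamma>) C1_differentiable_on (({0..1} - F') \<inter> reversepath \<gamma> -` cdom S i)"
    if "i \<in> indices S" for i
    by (rule C1_affine[OF F that open_UNIV rev]) (use F' in auto)
  ultimately have off: "C1_curve_off S F' (reversepath \<gamma>)"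
    using F by (auto simp: C1_curve_off_def F'_def)
  then show "piecewise_C1_curve S (reversepath \<gamma>)" using piecewise_C1_curve_iff by blast
  have "speed_off S F' (reversepath \<gamma>) t = speed_off S F \<gamma> (1 + -1 * t)" for t
  proof (cases "t \<in> {0..1} - F'")
    case True
    then show ?thesis
      using speed_affine[OF F, of "-1" t 1 UNIV "reversepath \<gamma>"] F'[OF True] rev
      by (simp add: speed_off_def)
  next
    case False
    then have "1 - t \<notin> {0..1} - F" using F'' by blast
    then show ?thesis using False by (simp add: speed_off_def)
  qed
  then have "curve_length S (reversepath \<gamma>) = (\<integral>\<^sup>+t. speed_off S F \<gamma> (1 + -1 * t) \<partial>lborel)"
    by (simp add: curve_length_eq[OF off])
  also have "\<dots> = (\<integral>\<^sup>+t. speed_off S F \<gamma> t \<partial>lborel)"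
    using nn_integral_real_affine[OF speed_off_measurable[OF F], of "-1" 1] by simp
  finally show "curve_length S (reversepath \<gamma>) = curve_length S \<gamma>"
    by (simp add: curve_length_eq[OF F])
qed

lemma joined_curve:
  assumes "piecewise_C1_curve S \<gamma>" "piecewise_C1_curve S \<eta>" "\<gamma> 1 = \<eta> 0"
  shows "piecewise_C1_curve S (\<gamma> +++ \<eta>)"
    "curve_length S (\<gamma> +++ \<eta>) = curve_length S \<gamma> + curve_length S \<eta>"
proof -
  obtain F G where F: "C1_curve_off S F \<gamma>" and G: "C1_curve_off S G \<eta>"
    using assms piecewise_C1_curve_iff by blast
  define H where "H = {0, 1/2, 1} \<union> (\<lambda>t. t / 2) ` F \<union> (\<lambda>t. (t + 1) / 2) ` G"
  have H1: "2 * t \<in> {0..1} - F" if "t \<in> {0..1} - H" "t < 1/2" for t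
    using that by (auto simp: H_def image_iff mult.commute)
  have H2: "2 * t - 1 \<in> {0..1} - G" if "t \<in> {0..1} - H" "t > 1/2" for t
    using that by (auto simp: H_def image_iff)
  have eq1: "(\<gamma> +++ \<eta>) s = \<gamma> (2 * s + 0)" if "s \<in> {..<1/2}" for s using that by (simp add: joinpaths_def)
  have eq2: "(\<gamma> +++ \<eta>) s = \<eta> (2 * s + -1)" if "s \<in> {1/2<..}" for s using that by (simp add: joinpaths_def)
  have "path \<gamma>" "path \<eta>" using F G by (auto simp: path_def C1_curve_off_def)
  then have "path (\<gamma> +++ \<eta>)"
    using assms(3) by (simp add: pathfinish_def pathstart_def)
  then have "continuous_on {0..1} (\<gamma> +++ \<eta>)" by (simp add: path_def)
  moreover have "(coord S i \<circ> (\<gamma> +++ \<eta>)) C1_differentiable_on (({0..1} - H) \<inter> (\<gamma> +++ \<eta>) -` cdom S i)"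
    if i: "i \<in> indices S" for i
  proof (rule C1_differentiable_on_Un_open[where U = "{..<1/2}" and V = "{1/2<..}"])
    show "(coord S i \<circ> (\<gamma> +++ \<eta>)) C1_differentiable_on (({0..1} - H) \<inter> (\<gamma> +++ \<eta>) -` cdom S i \<inter> {..<1/2})"
      by (rule C1_affine[OF F i open_lessThan eq1]) (use H1 in auto)
    show "(coord S i \<circ> (\<gamma> +++ \<eta>)) C1_differentiable_on (({0..1} - H) \<inter> (\<gamma> +++ \<eta>) -` cdom S i \<inter> {1/2<..})"
      by (rule C1_affine[OF G i open_greaterThan eq2]) (use H2 in auto)
  qed (auto simp: H_def)
  ultimately have off: "C1_curve_off S H (\<gamma> +++ \<eta>)"
    using F G by (auto simp: C1_curve_off_def H_def)
  then show "piecewise_C1_curve S (\<gamma> +++ \<eta>)" using piecewise_C1_curve_iff by blast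
  have "speed_off S H (\<gamma> +++ \<eta>) t = 2 * speed_off S F \<gamma> (0 + 2 * t) + 2 * speed_off S G \<eta> (-1 + 2 * t)"
    if t: "t \<notin> H" for t
  proof -
    consider "t < 0 \<or> t > 1" | "0 < t" "t < 1/2" | "1/2 < t" "t < 1"
      using t by (auto simp: H_def) linarith
    then show ?thesis
    proof cases
      case 1
      then show ?thesis by (auto simp: speed_off_def indicator_def)
    next
      case 2
      then have t': "t \<in> {0..1} - H" using t by auto
      have "speed S (\<gamma> +++ \<eta>) t = 2 * speed S \<gamma> (2 * t)"
        using speed_affine[OF F, of 2 t 0 "{..<1/2}" "\<gamma> +++ \<eta>"] H1[OF t' 2(2)] eq1 2 by simp
      then show ?thesis
        using t' H1[OF t' 2(2)] 2 by (simp add: speed_off_def ennreal_mult speed_nonneg)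
    next
      case 3
      then have t': "t \<in> {0..1} - H" using t by auto
      have "speed S (\<gamma> +++ \<eta>) t = 2 * speed S \<eta> (-1 + 2 * t)"
        using speed_affine[OF G, of 2 t "-1" "{1/2<..}" "\<gamma> +++ \<eta>"] H2[OF t' 3(1)] eq2 3 by simp
      then show ?thesis
        using t' H2[OF t' 3(1)] 3 by (simp add: speed_off_def ennreal_mult speed_nonneg)
    qed
  qed
  then have "curve_length S (\<gamma> +++ \<eta>) =
      (\<integral>\<^sup>+t. 2 * speed_off S F \<gamma> (0 + 2 * t) + 2 * speed_off S G \<eta> (-1 + 2 * t) \<partial>lborel)"
    unfolding curve_length_eq[OF off]
    using F G by (intro nn_integral_lborel_cong_finite[of H]) (auto simp: H_def C1_curve_off_def)
  also have "\<dots> = 2 * (\<integral>\<^sup>+t. speed_off S F \<gamma> (0 + 2 * t) \<partial>lborel) + 2 * (\<integral>\<^sup>+t. speed_off S G \<eta> (-1 + 2 * t) \<partial>lborel)"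
  proof -
    note [measurable] = speed_off_measurable[OF F] speed_off_measurable[OF G]
    show ?thesis by (subst nn_integral_add) (auto simp: nn_integral_cmult)
  qed
  also have "\<dots> = (\<integral>\<^sup>+t. speed_off S F \<gamma> t \<partial>lborel) + (\<integral>\<^sup>+t. speed_off S G \<eta> t \<partial>lborel)"
    using nn_integral_real_affine[OF speed_off_measurable[OF F], of 2 0]
      nn_integral_real_affine[OF speed_off_measurable[OF G], of 2 "-1"] by simp
  finally show "curve_length S (\<gamma> +++ \<eta>) = curve_length S \<gamma> + curve_length S \<eta>"
    by (simp add: curve_length_eq[OF F] curve_length_eq[OF G])
qed

section \<open>The Riemannian distance\<close>

lemma riemannian_dist_le:
  "piecewise_C1_curve S \<gamma> \<Longrightarrow> riemannian_dist S (\<gamma> 0) (\<gamma> 1) \<le> curve_length S \<gamma>"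
  unfolding riemannian_dist_def by (rule Inf_lower) blast

lemma riemannian_dist_lessE:
  assumes "riemannian_dist S a b < e"
  obtains \<gamma> where "piecewise_C1_curve S \<gamma>" "\<gamma> 0 = a" "\<gamma> 1 = b" "curve_length S \<gamma> < e"
  using assms unfolding riemannian_dist_def Inf_less_iff by blast

lemma riemannian_dist_sym_le: "riemannian_dist S b a \<le> riemannian_dist S a b"
proof (rule dense_le)
  have "riemannian_dist S b a \<le> curve_length S \<gamma>"
    if "piecewise_C1_curve S \<gamma>" "\<gamma> 0 = a" "\<gamma> 1 = b" for \<gamma>
    using riemannian_dist_le[OF reversed_curve(1)[OF that(1)]]
      reversed_curve(2)[OF that(1)] that by (simp add: reversepath_def)
  then show "x \<le> riemannian_dist S a b" if "x < riemannian_dist S b a" for x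
    using that unfolding riemannian_dist_def[of S a b] by (intro Inf_greatest) fastforce
qed

lemma riemannian_dist_sym: "riemannian_dist S a b = riemannian_dist S b a"
  by (intro antisym riemannian_dist_sym_le)

lemma riemannian_dist_triangle:
  "riemannian_dist S a c \<le> riemannian_dist S a b + riemannian_dist S b c"
proof (rule ennreal_le_epsilon)
  fix e :: real assume fin: "riemannian_dist S a b + riemannian_dist S b c < top" and "0 < e"
  have less: "x < x + ennreal (e / 2)" if "x < top" for x
    using that \<open>0 < e\<close> by (cases x) (auto simp flip: ennreal_plus simp: ennreal_less_iff)
  obtain \<gamma> where \<gamma>: "piecewise_C1_curve S \<gamma>" "\<gamma> 0 = a" "\<gamma> 1 = b"
    "curve_length S \<gamma> < riemannian_dist S a b + ennreal (e / 2)"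
    using riemannian_dist_lessE[OF less[of "riemannian_dist S a b"]] fin by auto
  obtain \<eta> where \<eta>: "piecewise_C1_curve S \<eta>" "\<eta> 0 = b" "\<eta> 1 = c"
    "curve_length S \<eta> < riemannian_dist S b c + ennreal (e / 2)"
    using riemannian_dist_lessE[OF less[of "riemannian_dist S b c"]] fin by auto
  have "\<gamma> 1 = \<eta> 0" using \<gamma> \<eta> by simp
  note joined = joined_curve[OF \<gamma>(1) \<eta>(1) this]
  have "riemannian_dist S a c \<le> curve_length S \<gamma> + curve_length S \<eta>"
    using riemannian_dist_le[OF joined(1)] joined(2) \<gamma> \<eta> by (simp add: joinpaths_def)
  also have "\<dots> \<le> (riemannian_dist S a b + ennreal (e / 2)) + (riemannian_dist S b c + ennreal (e / 2))"
    using \<gamma>(4) \<eta>(4) by (intro add_mono) auto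
  also have "\<dots> = riemannian_dist S a b + riemannian_dist S b c + (ennreal (e / 2) + ennreal (e / 2))"
    by (simp add: ac_simps)
  also have "ennreal (e / 2) + ennreal (e / 2) = ennreal e"
    using \<open>0 < e\<close> by (simp flip: ennreal_plus)
  finally show "riemannian_dist S a c \<le> riemannian_dist S a b + riemannian_dist S b c + ennreal e" .
qed

text \<open>
  The curve which is a straight line in the chart \<open>i\<close> has constant velocity \<open>v\<close> there.
\<close>

lemma riemannian_dist_chart_segment_le:
  assumes i: "i \<in> indices S"
    and segment: "\<And>t. t \<in> {0..1} \<Longrightarrow> y + t *\<^sub>R v \<in> coord S i ` cdom S i"
    and B: "\<And>t. t \<in> {0..1} \<Longrightarrow> sqrt (metric S i (param S i (y + t *\<^sub>R v)) v v) \<le> B"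
  shows "riemannian_dist S (param S i y) (param S i (y + v)) \<le> ennreal B"
proof -
  define \<gamma> where "\<gamma> t = param S i (y + t *\<^sub>R v)" for t
  let ?U = "coord S i ` cdom S i"
  have line: "((\<lambda>t. y + t *\<^sub>R v) has_vector_derivative v) (at t)" for t
    by (auto intro!: derivative_eq_intros)
  have cont_line: "continuous_on A (\<lambda>t. y + t *\<^sub>R v)" for A
    by (intro continuous_intros)
  have cont: "continuous_on {0..1} \<gamma>"
    unfolding \<gamma>_def
    by (rule continuous_on_compose2[OF continuous_on_param[OF i] cont_line]) (use segment in auto)
  have "(coord S j \<circ> \<gamma>) C1_differentiable_on ({0..1} \<inter> \<gamma> -` cdom S j)" if j: "j \<in> indices S" for j
  proof -
    let ?T = "coord S j \<circ> param S i"
    define D where "D t = frechet_derivative ?T (at (y + t *\<^sub>R v)) v" for t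
    have mem: "y + t *\<^sub>R v \<in> coord S i ` (cdom S i \<inter> cdom S j)" if "t \<in> {0..1} \<inter> \<gamma> -` cdom S j" for t
    proof -
      have "\<gamma> t \<in> cdom S i \<inter> cdom S j" "coord S i (\<gamma> t) = y + t *\<^sub>R v"
        using that segment param_in_cdom[OF i] coord_param[OF i]
        by (auto simp: \<gamma>_def)
      then show ?thesis by (metis imageI)
    qed
    have "((coord S j \<circ> \<gamma>) has_vector_derivative D t) (at t)" if "t \<in> {0..1} \<inter> \<gamma> -` cdom S j" for t
    proof -
      have "(?T has_derivative frechet_derivative ?T (at (y + t *\<^sub>R v))) (at (y + t *\<^sub>R v))"
        by (rule smooth_on_has_derivative[OF smooth_transition[OF i j] mem[OF that]])
      from vector_derivative_diff_chain_within[OF line has_derivative_at_withinI[OF this]]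
      show ?thesis unfolding D_def \<gamma>_def o_def .
    qed
    moreover have "continuous_on ({0..1} \<inter> \<gamma> -` cdom S j) D"
      unfolding D_def
      using continuous_on_compose2[OF smooth_on_continuous_derivative[OF smooth_transition[OF i j]]
          continuous_on_Pair[OF cont_line continuous_on_const[of _ v]], of "{0..1} \<inter> \<gamma> -` cdom S j"] mem
      by (simp add: image_subset_iff)
    ultimately show ?thesis
      unfolding C1_differentiable_on_def by (intro exI[of _ D]) auto
  qed
  then have curve: "piecewise_C1_curve S \<gamma>"
    unfolding piecewise_C1_curve_def using cont by (intro conjI exI[of _ "{}"]) auto
  have speed: "speed S \<gamma> t \<le> B" if t: "t \<in> {0<..<1}" for t
  proof -
    have "open ((\<lambda>t. y + t *\<^sub>R v) -` ?U)"
      by (rule open_vimage[OF open_coord_cdom[OF i] cont_line])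
    moreover have "t \<in> (\<lambda>t. y + t *\<^sub>R v) -` ?U" using segment[of t] t by simp
    moreover have "y + s *\<^sub>R v = (coord S i \<circ> \<gamma>) s" if "s \<in> (\<lambda>t. y + t *\<^sub>R v) -` ?U" for s
      using that coord_param[OF i] by (simp add: \<gamma>_def)
    ultimately have "((coord S i \<circ> \<gamma>) has_vector_derivative v) (at t)"
      by (rule has_vector_derivative_transform_within_open[OF line])
    moreover have "isCont \<gamma> t"
      using continuous_on_subset[OF cont, of "{0<..<1}"] t
      by (auto simp: continuous_on_eq_continuous_at greaterThanLessThan_subseteq_atLeastAtMost_iff)
    moreover have "i \<in> charts_at S (\<gamma> t)"
      unfolding \<gamma>_def using charts_at_param[OF i] segment t by auto
    ultimately have "speed S \<gamma> t = sqrt (metric S i (\<gamma> t) v v)"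
      using speed_eq by blast
    then show ?thesis using B[of t] t by (simp add: \<gamma>_def)
  qed
  have "curve_length S \<gamma> = (\<integral>\<^sup>+t. ennreal (speed S \<gamma> t) * indicator {0<..<1} t \<partial>lborel)"
    unfolding curve_length_def
    by (rule nn_integral_lborel_cong_finite[of "{0, 1}"]) (auto simp: indicator_def)
  also have "\<dots> \<le> (\<integral>\<^sup>+t. ennreal B * indicator {0<..<1::real} t \<partial>lborel)"
  proof (rule nn_integral_mono)
    show "ennreal (speed S \<gamma> t) * indicator {0<..<1} t \<le> ennreal B * indicator {0<..<1} t" for t
      using speed[of t] by (auto split: split_indicator intro: ennreal_leI)
  qed
  also have "\<dots> = ennreal B" by (simp add: nn_integral_cmult_indicator)
  finally show ?thesis
    using riemannian_dist_le[OF curve] by (simp add: \<gamma>_def)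
qed

lemma riemannian_dist_refl: "riemannian_dist S q q = 0"
proof -
  define i where "i = chart_at S q"
  have "i \<in> charts_at S q" unfolding i_def by (rule chart_at)
  then have "i \<in> indices S" "q \<in> cdom S i" by (auto simp: charts_at_def)
  then show ?thesis
    using riemannian_dist_chart_segment_le[of i "coord S i q" 0 0]
    by (simp add: param_coord metric_zero[OF \<open>i \<in> charts_at S q\<close>])
qed

text \<open>
  In a compact part of a chart the metric is comparable to the Euclidean one, by compactness of the
  Euclidean unit sphere.
\<close>

lemma metric_lower_bound:
  assumes i: "i \<in> indices S" and K: "compact K" "K \<noteq> {}" "K \<subseteq> coord S i ` cdom S i"
  obtains \<delta> where "\<delta> > 0" "\<And>y v. y \<in> K \<Longrightarrow> \<delta> * norm v \<le> sqrt (metric S i (param S i y) v v)"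
proof -
  let ?m = "\<lambda>(y, v). metric S i (param S i y) v v"
  have "continuous_on (K \<times> sphere 0 1) ?m"
    using K by (intro continuous_on_subset[OF continuous_on_metric[OF i]]) auto
  moreover have "K \<times> sphere (0::'e) 1 \<noteq> {}" using K by simp
  ultimately obtain z where z: "z \<in> K \<times> sphere 0 1" "\<And>w. w \<in> K \<times> sphere 0 1 \<Longrightarrow> ?m z \<le> ?m w"
    using continuous_attains_inf[of "K \<times> sphere 0 1" ?m] compact_Times[OF K(1) compact_sphere] by blast
  have charts: "i \<in> charts_at S (param S i y)" if "y \<in> K" for y
    using charts_at_param[OF i] K that by blast
  have "?m z > 0"
  proof -
    obtain y v where yv: "z = (y, v)" "y \<in> K" "norm v = 1" using z(1) by auto
    then have "v \<noteq> 0" by auto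
    then show ?thesis using metric_pos[OF charts[OF yv(2)]] yv(1) by simp
  qed
  moreover have "sqrt (?m z) * norm v \<le> sqrt (metric S i (param S i y) v v)" if "y \<in> K" for y v
  proof (cases "v = 0")
    case True
    then show ?thesis by (simp add: metric_zero[OF charts[OF that]])
  next
    case False
    have "?m z \<le> metric S i (param S i y) (v /\<^sub>R norm v) (v /\<^sub>R norm v)"
      using z(2)[of "(y, v /\<^sub>R norm v)"] that False by simp
    also have "\<dots> = metric S i (param S i y) v v / (norm v)\<^sup>2"
      by (simp only: metric_scaleR[OF charts[OF that]]) (simp add: power_divide divide_inverse power_inverse mult.commute)
    finally have "?m z * (norm v)\<^sup>2 \<le> metric S i (param S i y) v v"
      using False by (simp add: field_simps)
    then have "sqrt (?m z * (norm v)\<^sup>2) \<le> sqrt (metric S i (param S i y) v v)" by simp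
    then show ?thesis by (simp add: real_sqrt_mult)
  qed
  ultimately show thesis by (intro that[of "sqrt (?m z)"]) auto
qed

lemma metric_upper_bound:
  assumes i: "i \<in> indices S" and K: "compact K" "K \<noteq> {}" "K \<subseteq> coord S i ` cdom S i"
  obtains C where "\<And>y v. y \<in> K \<Longrightarrow> norm v = 1 \<Longrightarrow> metric S i (param S i y) v v \<le> C"
proof -
  let ?m = "\<lambda>(y, v). metric S i (param S i y) v v"
  have "continuous_on (K \<times> sphere 0 1) ?m"
    using K by (intro continuous_on_subset[OF continuous_on_metric[OF i]]) auto
  moreover have "K \<times> sphere (0::'e) 1 \<noteq> {}" using K by simp
  ultimately obtain z where "\<And>w. w \<in> K \<times> sphere 0 1 \<Longrightarrow> ?m w \<le> ?m z"
    using continuous_attains_sup[of "K \<times> sphere 0 1" ?m] compact_Times[OF K(1) compact_sphere] by blast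
  then show thesis by (intro that[of "?m z"]) force
qed

text \<open>
  In a small chart ball around \<open>a\<close> the metric dominates \<open>\<delta>\<^sup>2\<close> times the Euclidean one. A curve from \<open>a\<close> of
  length less than \<open>\<delta> r\<close> therefore stays, until the first time at which it leaves the ball of radius
  \<open>r\<close>, in a closed ball of smaller radius. By continuity it is in this closed ball at that time as
  well, so it never leaves.
\<close>

lemma riemannian_dist_small_imp_mem_open:
  assumes "open U" "a \<in> U"
  obtains e where "e > 0" "\<And>b. riemannian_dist S a b < ennreal e \<Longrightarrow> b \<in> U"
proof -
  define i where "i = chart_at S a"
  have i: "i \<in> indices S" "a \<in> cdom S i"
    using chart_at[of a] by (auto simp: charts_at_def i_def)
  define z where "z = coord S i a"
  have "open (coord S i ` (cdom S i \<inter> U))"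
    by (rule open_coord_image[OF i(1)]) (use open_cdom[OF i(1)] assms in auto)
  then obtain r where "r > 0" and r: "cball z r \<subseteq> coord S i ` (cdom S i \<inter> U)"
    using open_contains_cball_eq i assms by (metis IntI imageI z_def)
  then have r': "cball z r \<subseteq> coord S i ` cdom S i" by blast
  obtain \<delta> where "\<delta> > 0" and
    \<delta>: "\<And>y v. y \<in> cball z r \<Longrightarrow> \<delta> * norm v \<le> sqrt (metric S i (param S i y) v v)"
    using metric_lower_bound[OF i(1) compact_cball _ r'] \<open>r > 0\<close> by auto
  define V where "V = param S i ` ball z r"
  have "open V" unfolding V_def
    using r' ball_subset_cball by (intro open_param_image[OF i(1)]) blast+
  have "V \<subseteq> U"
  proof
    fix q assume "q \<in> V"
    then obtain y where y: "y \<in> cball z r" "q = param S i y"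
      using ball_subset_cball[of z r] unfolding V_def by blast
    then obtain q' where "q' \<in> cdom S i \<inter> U" "y = coord S i q'" using r by blast
    then show "q \<in> U" using y param_coord[OF i(1)] by simp
  qed
  have V_cdom: "V \<subseteq> cdom S i"
    unfolding V_def image_subset_iff
    using r' ball_subset_cball[of z r] param_in_cdom[OF i(1)] by blast
  have "a \<in> V" unfolding V_def
    by (rule image_eqI[of _ _ z]) (use \<open>r > 0\<close> in \<open>simp_all add: z_def param_coord[OF i]\<close>)
  have "b \<in> V" if close: "riemannian_dist S a b < ennreal (\<delta> * r)" for b
  proof (rule ccontr)
    assume "b \<notin> V"
    obtain \<gamma> where \<gamma>: "piecewise_C1_curve S \<gamma>" "\<gamma> 0 = a" "\<gamma> 1 = b" "curve_length S \<gamma> < ennreal (\<delta> * r)"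
      using riemannian_dist_lessE[OF close] .
    obtain F where F: "C1_curve_off S F \<gamma>" using \<gamma>(1) piecewise_C1_curve_iff by blast
    have cont: "continuous_on {0..1} \<gamma>" using F by (simp add: C1_curve_off_def)
    define L where "L = enn2real (curve_length S \<gamma>)"
    have "curve_length S \<gamma> < top" using \<gamma>(4) by (rule order_less_trans) simp
    then have L: "curve_length S \<gamma> = ennreal L" "L < \<delta> * r"
      using \<gamma>(4) by (auto simp: L_def ennreal_less_iff)
    have L_nonneg: "L \<ge> 0" by (simp add: L_def)
    define \<rho> where "\<rho> = L / \<delta>"
    have "\<rho> < r" using L \<open>\<delta> > 0\<close> by (simp add: \<rho>_def field_simps)
    define T where "T = {0..1} \<inter> \<gamma> -` (- V)"
    have "closed T" unfolding T_def
      using \<open>open V\<close> by (intro continuous_closed_preimage[OF cont]) auto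
    moreover have "1 \<in> T" using \<gamma>(3) \<open>b \<notin> V\<close> by (simp add: T_def)
    moreover have "bdd_below T" by (rule bdd_belowI[of _ 0]) (simp add: T_def)
    ultimately have \<tau>: "Inf T \<in> T" "\<And>t. t \<in> T \<Longrightarrow> Inf T \<le> t"
      using closed_contains_Inf cInf_lower by blast+
    \<comment> \<open>\<open>\<tau>\<close> is the first time at which the curve is outside \<open>V\<close>.\<close>
    define \<tau> where "\<tau> = Inf T"
    have "\<tau> \<noteq> 0" "0 \<le> \<tau>" "\<tau> \<le> 1" using \<tau>(1) \<open>a \<in> V\<close> \<gamma>(2) by (auto simp: T_def \<tau>_def)
    have before: "\<gamma> s \<in> V" if "0 \<le> s" "s < \<tau>" for s
      using \<tau>(2)[of s] that \<open>\<tau> \<le> 1\<close> by (force simp: T_def \<tau>_def)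
    have bound: "\<gamma> t \<in> param S i ` cball z \<rho>" if t: "0 \<le> t" "t < \<tau>" for t
    proof -
      have V: "\<gamma> s \<in> V" if "s \<in> {0..t}" for s using before that t by simp
      define D where "D s = vector_derivative (coord S i \<circ> \<gamma>) (at s)" for s
      have sub: "{0..t} - F \<subseteq> ({0..1} - F) \<inter> \<gamma> -` cdom S i"
      proof
        fix s assume "s \<in> {0..t} - F"
        then show "s \<in> ({0..1} - F) \<inter> \<gamma> -` cdom S i"
          using V[of s] V_cdom t \<open>\<tau> \<le> 1\<close> by auto
      qed
      have chart: "i \<in> charts_at S (\<gamma> s)" if "s \<in> {0..t}" for s
        using V[OF that] V_cdom i by (auto simp: charts_at_def)
      have "ennreal (norm ((coord S i \<circ> \<gamma>) t - (coord S i \<circ> \<gamma>) 0)) \<le>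
          (\<integral>\<^sup>+s\<in>{0..t}. ennreal (norm (D s)) \<partial>lborel)"
      proof (rule norm_increment_le_nn_integral[OF t(1), where F = F])
        show "continuous_on {0..t} (coord S i \<circ> \<gamma>)"
        proof (rule continuous_on_compose[OF continuous_on_subset[OF cont]
              continuous_on_subset[OF continuous_on_coord[OF i(1)]]])
          show "{0..t} \<subseteq> {0..1}" using t \<open>\<tau> \<le> 1\<close> by simp
          show "\<gamma> ` {0..t} \<subseteq> cdom S i" using V V_cdom by blast
        qed
        show "finite F" using F by (simp add: C1_curve_off_def)
        show "((coord S i \<circ> \<gamma>) has_vector_derivative D s) (at s)" if "s \<in> {0..t} - F" for s
          unfolding D_def
        proof (rule C1_curve_off_derivative(1)[OF F])
          show "s \<in> {0..1} - F" using sub that by blast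
          show "i \<in> charts_at S (\<gamma> s)" using chart that by blast
        qed
        show "continuous_on ({0..t} - F) D"
          using F i(1) continuous_on_subset[OF _ sub]
          by (auto simp: C1_curve_off_def C1_differentiable_on_eq D_def)
      qed
      also have "\<dots> \<le> (\<integral>\<^sup>+s. ennreal (1 / \<delta>) * speed_off S F \<gamma> s \<partial>lborel)"
      proof -
        have "ennreal (norm (D s)) * indicator {0..t} s \<le> ennreal (1 / \<delta>) * speed_off S F \<gamma> s" if "s \<notin> F" for s
        proof (cases "s \<in> {0..t}")
          case True
          then have s: "s \<in> {0..1} - F" using sub that by blast
          have "coord S i (\<gamma> s) \<in> ball z r"
          proof -
            obtain y where y: "y \<in> ball z r" "\<gamma> s = param S i y" using V[OF True] by (auto simp: V_def)
            then have "y \<in> coord S i ` cdom S i" using r' ball_subset_cball[of z r] by blast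
            then show ?thesis using y coord_param[OF i(1)] by simp
          qed
          then have "\<delta> * norm (D s) \<le> sqrt (metric S i (param S i (coord S i (\<gamma> s))) (D s) (D s))"
            using \<delta> ball_subset_cball by blast
          also have "\<dots> = speed S \<gamma> s"
            using C1_curve_off_derivative(2)[OF F s chart[OF True]] param_coord[OF i(1)]
              chart[OF True] by (simp add: D_def charts_at_def)
          finally have "norm (D s) \<le> 1 / \<delta> * speed S \<gamma> s" using \<open>\<delta> > 0\<close> by (simp add: field_simps)
          then show ?thesis
            using True s \<open>\<delta> > 0\<close> speed_nonneg
            by (auto simp: speed_off_def ennreal_mult[symmetric] intro!: ennreal_leI)
        qed simp
        note pointwise = this
        have "finite F" using F by (simp add: C1_curve_off_def)
        show ?thesis
        proof (rule nn_integral_mono_AE)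
          show "AE s in lborel. ennreal (norm (D s)) * indicator {0..t} s \<le> ennreal (1 / \<delta>) * speed_off S F \<gamma> s"
            using AE_not_in[OF finite_imp_null_set_lborel[OF \<open>finite F\<close>]]
            by (rule eventually_mono) (rule pointwise)
        qed
      qed
      also have "\<dots> = ennreal (1 / \<delta>) * curve_length S \<gamma>"
        unfolding curve_length_eq[OF F]
        using speed_off_measurable[OF F] by (intro nn_integral_cmult) simp
      also have "\<dots> = ennreal \<rho>"
        using \<open>\<delta> > 0\<close> by (simp add: L \<rho>_def L_nonneg ennreal_mult[symmetric])
      finally have "norm (coord S i (\<gamma> t) - z) \<le> \<rho>"
        using \<open>\<delta> > 0\<close> by (simp add: \<gamma>(2) z_def \<rho>_def L_nonneg ennreal_le_iff)
      then have "coord S i (\<gamma> t) \<in> cball z \<rho>" by (simp add: dist_norm norm_minus_commute)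
      then show ?thesis
        using param_coord[OF i(1), of "\<gamma> t"] V[of t] V_cdom t
        by (intro image_eqI[of _ _ "coord S i (\<gamma> t)"]) auto
    qed
    have "compact (param S i ` cball z \<rho>)"
      using r' \<open>\<rho> < r\<close>
      by (intro compact_continuous_image continuous_on_subset[OF continuous_on_param[OF i(1)]]) auto
    then have "closed ({0..1} \<inter> \<gamma> -` (param S i ` cball z \<rho>))"
      by (intro continuous_closed_preimage[OF cont] compact_imp_closed) auto
    moreover have "{0..<\<tau>} \<subseteq> {0..1} \<inter> \<gamma> -` (param S i ` cball z \<rho>)"
      using bound \<open>\<tau> \<le> 1\<close> by auto
    ultimately have "closure {0..<\<tau>} \<subseteq> {0..1} \<inter> \<gamma> -` (param S i ` cball z \<rho>)"
      by (rule closure_minimal[rotated])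
    then have "\<gamma> \<tau> \<in> param S i ` cball z \<rho>" using \<open>\<tau> \<noteq> 0\<close> \<open>0 \<le> \<tau>\<close> by auto
    then have "\<gamma> \<tau> \<in> V" using \<open>\<rho> < r\<close> unfolding V_def by auto
    then show False using \<tau>(1) by (simp add: T_def \<tau>_def)
  qed
  then show thesis
    using that[of "\<delta> * r"] \<open>\<delta> > 0\<close> \<open>r > 0\<close> \<open>V \<subseteq> U\<close> by auto
qed

section \<open>Almost critical points on complete manifolds\<close>

text \<open>
  If \<open>f\<close> decreases along \<open>v\<close> at a rate greater than \<open>c\<close> while \<open>v\<close> has length less than \<open>B\<close>, then a short
  step in the direction \<open>v\<close> lowers \<open>f\<close> by at least \<open>c / B\<close> times the distance covered.
\<close>

lemma descent_step:
  assumes i: "i \<in> charts_at S q"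
    and D: "((f \<circ> param S i) has_derivative D) (at (coord S i q))"
    and v: "D v < - c" "sqrt (metric S i q v v) < B" and "c > 0"
  shows "\<exists>q'. f q' < f q \<and> riemannian_dist S q q' \<le> ennreal (B / c * (f q - f q'))"
proof -
  have i': "i \<in> indices S" "q \<in> cdom S i" using i by (auto simp: charts_at_def)
  define y where "y = coord S i q"
  have q: "param S i y = q" using param_coord i' by (simp add: y_def)
  have "B > 0" using v(2) metric_nonneg[OF i, of v] real_sqrt_ge_zero by (meson order_le_less_trans)
  let ?U = "coord S i ` cdom S i"
  have "continuous_on ?U (\<lambda>y. sqrt (metric S i (param S i y) v v))"
    by (intro continuous_on_real_sqrt continuous_on_metric_compose[OF i'(1)]
        continuous_on_id continuous_on_const) auto
  then have "open (?U \<inter> (\<lambda>y. sqrt (metric S i (param S i y) v v)) -` {..<B})"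
    using open_coord_cdom[OF i'(1)] by (simp add: continuous_open_preimage)
  moreover have "y \<in> ?U \<inter> (\<lambda>y. sqrt (metric S i (param S i y) v v)) -` {..<B}"
    using i' v q by (simp add: y_def)
  ultimately obtain \<epsilon> where "\<epsilon> > 0"
    and \<epsilon>: "ball y \<epsilon> \<subseteq> ?U \<inter> (\<lambda>y. sqrt (metric S i (param S i y) v v)) -` {..<B}"
    using openE by blast
  define \<psi> where "\<psi> s = f (param S i (y + s *\<^sub>R v)) + c * s" for s
  have "((\<lambda>s. y + s *\<^sub>R v) has_vector_derivative v) (at 0)"
    by (auto intro!: derivative_eq_intros)
  moreover have "((f \<circ> param S i) has_derivative D) (at (y + 0 *\<^sub>R v))"
    using D by (simp add: y_def)
  ultimately have "((\<lambda>s. f (param S i (y + s *\<^sub>R v))) has_vector_derivative D v) (at 0)"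
    using vector_derivative_diff_chain_within[OF _ has_derivative_at_withinI]
    by (fastforce simp: o_def)
  then have "(\<psi> has_real_derivative D v + c) (at 0)"
    unfolding \<psi>_def by (auto intro!: derivative_eq_intros simp: has_real_derivative_iff_has_vector_derivative)
  then obtain d where "d > 0" and d: "\<And>h. 0 < h \<Longrightarrow> h < d \<Longrightarrow> \<psi> (0 + h) < \<psi> 0"
    using DERIV_neg_dec_right[of \<psi> "D v + c" 0] v by auto
  define s where "s = min (d / 2) (\<epsilon> / (2 * (norm v + 1)))"
  have s: "0 < s" "s < d" using \<open>d > 0\<close> \<open>\<epsilon> > 0\<close> by (auto simp: s_def add_nonneg_pos)
  have sv: "s * norm v < \<epsilon>"
  proof -
    have "s * norm v \<le> \<epsilon> / (2 * (norm v + 1)) * norm v"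
      by (intro mult_right_mono) (auto simp: s_def)
    also have "\<dots> < \<epsilon>" using \<open>\<epsilon> > 0\<close>
      by (simp add: divide_less_eq add_nonneg_pos)
    finally show ?thesis .
  qed
  define q' where "q' = param S i (y + s *\<^sub>R v)"
  have decrease: "c * s < f q - f q'"
    using d[OF s] by (simp add: \<psi>_def q'_def q)
  have ball: "y + t *\<^sub>R (s *\<^sub>R v) \<in> ball y \<epsilon>" if "t \<in> {0..1}" for t
  proof -
    have "norm (t *\<^sub>R (s *\<^sub>R v)) = t * (s * norm v)" using that s by simp
    also have "\<dots> \<le> 1 * (s * norm v)" using that s by (intro mult_right_mono) auto
    finally show ?thesis using sv by (simp add: dist_norm)
  qed
  have "riemannian_dist S (param S i y) (param S i (y + s *\<^sub>R v)) \<le> ennreal (s * B)"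
  proof (rule riemannian_dist_chart_segment_le[OF i'(1)])
    fix t :: real assume t: "t \<in> {0..1}"
    have in_U: "y + t *\<^sub>R s *\<^sub>R v \<in> ?U" using ball[OF t] \<epsilon> by blast
    then show "y + t *\<^sub>R s *\<^sub>R v \<in> ?U" .
    have "sqrt (metric S i (param S i (y + t *\<^sub>R s *\<^sub>R v)) (s *\<^sub>R v) (s *\<^sub>R v)) =
        s * sqrt (metric S i (param S i (y + t *\<^sub>R s *\<^sub>R v)) v v)"
      using s by (simp only: metric_scaleR[OF charts_at_param[OF i'(1) in_U]] real_sqrt_mult) simp
    also have "\<dots> \<le> s * B"
      using ball[OF t] \<epsilon> s by (intro mult_left_mono) (auto intro: less_imp_le)
    finally show "sqrt (metric S i (param S i (y + t *\<^sub>R s *\<^sub>R v)) (s *\<^sub>R v) (s *\<^sub>R v)) \<le> s * B" .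
  qed
  also have "ennreal (s * B) \<le> ennreal (B / c * (f q - f q'))"
  proof (rule ennreal_leI)
    have "B / c * (c * s) \<le> B / c * (f q - f q')"
      using \<open>B > 0\<close> \<open>c > 0\<close> decrease by (intro mult_left_mono) auto
    then show "s * B \<le> B / c * (f q - f q')" using \<open>c > 0\<close> by (simp add: mult.commute)
  qed
  finally have "riemannian_dist S q q' \<le> ennreal (B / c * (f q - f q'))" by (simp add: q q'_def)
  moreover have "f q' < f q" using decrease s \<open>c > 0\<close> by (smt (verit) mult_pos_pos)
  ultimately show ?thesis by blast
qed

text \<open>
  The point found by Caristi's argument admits no such step.
\<close>

theorem almost_critical_point:
  assumes complete: "complete_manifold S" and cont: "continuous_on UNIV f"
    and bounded: "\<And>q. l \<le> f q" and "B > 0" "c > (0 :: real)"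
  obtains a where "f a \<le> f q0"
    "\<And>i D v. i \<in> charts_at S a \<Longrightarrow> ((f \<circ> param S i) has_derivative D) (at (coord S i a)) \<Longrightarrow>
       sqrt (metric S i a v v) < B \<Longrightarrow> - c \<le> D v"
proof -
  have lim: "(\<lambda>n. f (X n)) \<longlonglongrightarrow> f a" if X: "\<forall>e>0. \<exists>K. \<forall>n\<ge>K. riemannian_dist S (X n) a < e"
    for X :: "nat \<Rightarrow> 's" and a
  proof (rule topological_tendstoI)
    fix W assume "open W" "f a \<in> W"
    then have "open (f -` W)" "a \<in> f -` W" using open_vimage[OF _ cont] by auto
    from riemannian_dist_small_imp_mem_open[OF this]
    obtain e where e: "e > 0" "\<And>b. riemannian_dist S a b < ennreal e \<Longrightarrow> b \<in> f -` W" by blast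
    have "ennreal e > 0" using e(1) by simp
    with X obtain K where K: "\<And>n. n \<ge> K \<Longrightarrow> riemannian_dist S (X n) a < ennreal e" by blast
    show "\<forall>\<^sub>F n in sequentially. f (X n) \<in> W"
      using eventually_ge_at_top[of K]
      by eventually_elim (use K e(2) riemannian_dist_sym in force)
  qed
  have compl: "\<exists>a. \<forall>e>0. \<exists>K. \<forall>n\<ge>K. riemannian_dist S (X n) a < e"
    if "\<forall>e>0. \<exists>K. \<forall>m\<ge>K. \<forall>n\<ge>K. riemannian_dist S (X m) (X n) < e" for X :: "nat \<Rightarrow> 's"
    using complete that unfolding complete_manifold_def by blast
  have "B / c > 0" using \<open>B > 0\<close> \<open>c > 0\<close> by simp
  obtain a where a: "f a \<le> f q0"
    "\<And>q. f q < f a \<Longrightarrow> \<not> riemannian_dist S a q \<le> ennreal (B / c * (f a - f q))"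
    using caristi[of "riemannian_dist S" f, OF riemannian_dist_refl riemannian_dist_sym
        riemannian_dist_triangle compl lim bounded \<open>B / c > 0\<close>] by blast
  show thesis
  proof (rule that[OF a(1)], rule ccontr)
    fix i D v
    assume "i \<in> charts_at S a" "((f \<circ> param S i) has_derivative D) (at (coord S i a))"
      "sqrt (metric S i a v v) < B" "\<not> - c \<le> D v"
    then show False using descent_step[of i a f D v c B] \<open>c > 0\<close> a(2) by auto
  qed
qed

lemma constant_if_derivative_zero:
  fixes f :: "'s \<Rightarrow> real"
  assumes "connected (UNIV :: 's set)"
    and deriv: "\<And>q i. i \<in> charts_at S q \<Longrightarrow> ((f \<circ> param S i) has_derivative (\<lambda>v. 0)) (at (coord S i q))"
  shows "\<exists>c. \<forall>q. f q = c"
proof -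
  have "f constant_on UNIV"
  proof (rule locally_constant_imp_constant[OF assms(1)])
    fix a
    define i where "i = chart_at S a"
    have i: "i \<in> indices S" "a \<in> cdom S i"
      using chart_at[of a] by (auto simp: charts_at_def i_def)
    obtain r where r: "r > 0" "ball (coord S i a) r \<subseteq> coord S i ` cdom S i"
      using openE[OF open_coord_cdom[OF i(1)]] i by blast
    define V where "V = param S i ` ball (coord S i a) r"
    have "f q = f a" if q: "q \<in> V" for q
    proof -
      obtain y where y: "y \<in> ball (coord S i a) r" "q = param S i y" using q by (auto simp: V_def)
      have "((f \<circ> param S i) has_derivative (\<lambda>v. 0)) (at x within ball (coord S i a) r)"
        if "x \<in> ball (coord S i a) r" for x
      proof -
        have x: "x \<in> coord S i ` cdom S i" using that r by blast
        show ?thesis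
          using deriv[OF charts_at_param[OF i(1) x]]
          by (simp only: coord_param[OF i(1) x] has_derivative_at_withinI)
      qed
      then have "(f \<circ> param S i) y = (f \<circ> param S i) (coord S i a)"
        by (rule has_derivative_zero_unique[OF convex_ball _ y(1)]) (use r(1) in auto)
      then show ?thesis using y param_coord[OF i] by simp
    qed
    moreover have "open V" unfolding V_def
      by (rule open_param_image[OF i(1) open_ball r(2)])
    then have "openin (top_of_set UNIV) V" by simp
    moreover have "a \<in> V" unfolding V_def
      by (rule image_eqI[of _ _ "coord S i a"]) (use r(1) in \<open>simp_all add: param_coord[OF i]\<close>)
    ultimately show "\<exists>T. openin (top_of_set UNIV) T \<and> a \<in> T \<and> (\<forall>x\<in>T. f x = f a)"
      by blast
  qed
  then show ?thesis by (auto simp: constant_on_def)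
qed

end

section \<open>Locally expanding maps\<close>

text \<open>
  Around any point of \<open>M\<close> there is a chart ball \<open>V\<close> of radius \<open>R / 4\<close> which is either contained in
  the range of \<open>y\<close> or disjoint from it: if \<open>y q0\<close> and the target \<open>m'\<close> lie in \<open>V\<close>, the function
  \<open>f\<close> measuring how far \<open>y q\<close> is from \<open>m'\<close> in the chart starts below its cutoff. At a point
  where \<open>0 < f < R / 2\<close> there is a direction \<open>v\<close> which \<open>y\<close> maps to the unit vector pointing to the
  target, so that \<open>f\<close> decreases along \<open>v\<close> at rate 1, while the length of \<open>v\<close> is bounded by a constant.
  An almost critical point below the cutoff must therefore be mapped to \<open>m'\<close>.
\<close>

lemma surj_if_locally_expanding:
  fixes S :: "('j, 's::{t2_space, second_countable_topology}, 'd::euclidean_space) rmfd"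
    and M :: "('i, 'm::{t2_space, second_countable_topology}, 'e::euclidean_space) rmfd"
  assumes S: "riemannian_manifold S" "complete_manifold S"
    and M: "riemannian_manifold M" "connected (UNIV :: 'm set)"
    and cont: "continuous_on UNIV y" and "\<kappa> \<ge> 0"
    and deriv: "\<And>q i j. j \<in> charts_at S q \<Longrightarrow> i \<in> charts_at M (y q) \<Longrightarrow>
      \<exists>L. ((coord M i \<circ> y \<circ> param S j) has_derivative L) (at (coord S j q)) \<and> surj L \<and>
        (\<forall>v. sqrt (metric S j q v v) \<le> \<kappa> * sqrt (metric M i (y q) (L v) (L v)))"
  shows "surj y"
proof -
  have "(\<lambda>m. m \<in> range y) constant_on UNIV"
  proof (rule locally_constant_imp_constant[OF M(2)])
    fix a
    define i where "i = chart_at M a"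
    have i: "i \<in> indices M" "a \<in> cdom M i"
      using chart_at[OF M(1), of a] by (auto simp: charts_at_def i_def)
    define z where "z = coord M i a"
    obtain R where "R > 0" and R: "cball z R \<subseteq> coord M i ` cdom M i"
      using open_contains_cball_eq[OF open_coord_cdom[OF M(1) i(1)]] i by (metis imageI z_def)
    then have ball_R: "ball z R \<subseteq> coord M i ` cdom M i" using ball_subset_cball[of z R] by blast
    obtain C where C: "\<And>y v. y \<in> cball z R \<Longrightarrow> norm v = 1 \<Longrightarrow> metric M i (param M i y) v v \<le> C"
      using metric_upper_bound[OF M(1) i(1) compact_cball _ R] \<open>R > 0\<close> by auto
    define V where "V = param M i ` ball z (R / 4)"
    have reach: "m' \<in> range y" if m: "m \<in> V" "m' \<in> V" "m \<in> range y" for m m'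
    proof -
      obtain b where b: "b \<in> ball z (R / 4)" "m = param M i b" using m(1) by (auto simp: V_def)
      obtain c where c: "c \<in> ball z (R / 4)" "m' = param M i c" using m(2) by (auto simp: V_def)
      obtain q0 where q0: "y q0 = m" using m(3) by auto
      \<comment> \<open>The cutoff radius is \<open>R / 2\<close>: it exceeds the distance of two points of the ball of radius \<open>R / 4\<close>, and the ball around \<open>c\<close> still fits into the chart.\<close>
      have cball_c: "cball c (R / 2) \<subseteq> ball z R"
      proof
        fix x assume "x \<in> cball c (R / 2)"
        then show "x \<in> ball z R" using dist_triangle[of z x c] c(1) \<open>R > 0\<close> by simp
      qed
      have "dist b c < R / 2"
        using dist_triangle[of b c z] b(1) c(1) by (simp add: dist_commute)
      define O1 where "O1 = param M i ` ball z R"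
      define K where "K = param M i ` cball c (R / 2)"
      define G where "G m = (if m \<in> O1 then min (R / 2) (dist (coord M i m) c) else R / 2)" for m
      have "open O1" unfolding O1_def by (rule open_param_image[OF M(1) i(1) open_ball ball_R])
      have O1_cdom: "O1 \<subseteq> cdom M i"
        unfolding O1_def image_subset_iff using ball_R param_in_cdom[OF M(1) i(1)] by blast
      have coord_O1: "coord M i m \<in> ball z R" if m_in: "m \<in> O1" for m
      proof -
        obtain x where x: "x \<in> ball z R" "m = param M i x" using m_in by (auto simp: O1_def)
        then have "x \<in> coord M i ` cdom M i" using ball_R by blast
        then show ?thesis using x coord_param[OF M(1) i(1)] by simp
      qed
      have "compact K" unfolding K_def
        using cball_c ball_R
        by (intro compact_continuous_image continuous_on_subset[OF continuous_on_param[OF M(1) i(1)]]) auto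
      then have "open (- K)" by (simp add: compact_imp_closed open_Compl)
      have "continuous_on O1 G"
      proof (rule continuous_on_eq)
        show "continuous_on O1 (\<lambda>m. min (R / 2) (dist (coord M i m) c))"
          using continuous_on_subset[OF continuous_on_coord[OF M(1) i(1)] O1_cdom]
          by (intro continuous_on_min continuous_on_dist continuous_on_const)
      qed (simp add: G_def)
      moreover have "continuous_on (- K) G"
      proof (rule continuous_on_eq[OF continuous_on_const])
        fix m assume "m \<in> - K"
        have "R / 2 \<le> dist (coord M i m) c" if "m \<in> O1"
        proof (rule ccontr)
          assume "\<not> R / 2 \<le> dist (coord M i m) c"
          then have "coord M i m \<in> cball c (R / 2)" by (simp add: dist_commute)
          moreover have "m = param M i (coord M i m)"
            using param_coord[OF M(1) i(1)] that O1_cdom by auto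
          ultimately have "m \<in> K" unfolding K_def by blast
          then show False using \<open>m \<in> - K\<close> by simp
        qed
        then show "R / 2 = G m" by (simp add: G_def)
      qed
      moreover have "K \<subseteq> O1" unfolding K_def O1_def using cball_c by blast
      then have "O1 \<union> - K = UNIV" by blast
      ultimately have cont_G: "continuous_on UNIV G"
        using continuous_on_open_Un[OF \<open>open O1\<close> \<open>open (- K)\<close>] by metis
      define f where "f = G \<circ> y"
      have cont_f: "continuous_on UNIV f"
        unfolding f_def using cont continuous_on_subset[OF cont_G] by (intro continuous_on_compose) auto
      have f_nonneg: "0 \<le> f q" for q using \<open>R > 0\<close> by (simp add: f_def G_def)
      \<comment> \<open>The directions used below have length at most \<open>\<kappa> * sqrt \<bar>C\<bar>\<close>; one is added to make the bound strict.\<close>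
      have "\<kappa> * sqrt \<bar>C\<bar> + 1 > 0" using \<open>\<kappa> \<ge> 0\<close> by (simp add: add_nonneg_pos)
      then obtain p where p: "f p \<le> f q0" and
        crit: "\<And>j D v. j \<in> charts_at S p \<Longrightarrow> ((f \<circ> param S j) has_derivative D) (at (coord S j p)) \<Longrightarrow>
           sqrt (metric S j p v v) < \<kappa> * sqrt \<bar>C\<bar> + 1 \<Longrightarrow> - (1 / 2) \<le> D v"
        using almost_critical_point[OF S cont_f f_nonneg, of "\<kappa> * sqrt \<bar>C\<bar> + 1" "1 / 2" q0]
        by (metis zero_less_divide_1_iff zero_less_numeral)
      have "b \<in> ball z R" using b(1) \<open>R > 0\<close> by simp
      then have "m \<in> O1" and "coord M i m = b"
        using ball_R coord_param[OF M(1) i(1)] b(2) unfolding O1_def by blast+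
      then have "f q0 < R / 2"
        using \<open>dist b c < R / 2\<close> by (simp add: f_def G_def q0)
      then have "f p < R / 2" using p by simp
      then have yp: "y p \<in> O1" "dist (coord M i (y p)) c < R / 2"
        by (auto simp: f_def G_def split: if_splits)
      define u where "u = coord M i (y p)"
      have "u = c"
      proof (rule ccontr)
        assume "u \<noteq> c"
        define j where "j = chart_at S p"
        have j: "j \<in> charts_at S p" unfolding j_def by (rule chart_at[OF S(1)])
        then have j': "j \<in> indices S" "p \<in> cdom S j" by (auto simp: charts_at_def)
        have i_yp: "i \<in> charts_at M (y p)" using yp(1) O1_cdom i(1) by (auto simp: charts_at_def)
        obtain L where L: "((coord M i \<circ> y \<circ> param S j) has_derivative L) (at (coord S j p))" "surj L"
          "\<And>v. sqrt (metric S j p v v) \<le> \<kappa> * sqrt (metric M i (y p) (L v) (L v))"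
          using deriv[OF j i_yp] by blast
        define Y where "Y = coord M i \<circ> y \<circ> param S j"
        have Yp: "Y (coord S j p) = u" using param_coord[OF S(1) j'] by (simp add: Y_def u_def)
        have "((\<lambda>v. v - c) has_derivative (\<lambda>v. v)) (at u)"
          by (auto intro!: derivative_eq_intros)
        from has_derivative_compose[OF L(1)[folded Y_def], unfolded Yp, OF this]
        have "((\<lambda>x. Y x - c) has_derivative L) (at (coord S j p))" .
        moreover have "(norm has_derivative (\<lambda>v. inner v (sgn (u - c)))) (at (u - c))"
          using \<open>u \<noteq> c\<close> by (intro has_derivative_norm) simp
        ultimately have d: "((\<lambda>x. norm (Y x - c)) has_derivative (\<lambda>v. inner (L v) (sgn (u - c)))) (at (coord S j p))"
          using has_derivative_compose[of "\<lambda>x. Y x - c" L "coord S j p" UNIV norm "\<lambda>v. inner v (sgn (u - c))"]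
          by (simp add: Yp)
        define W where "W = y -` (param M i ` (ball z R \<inter> ball c (R / 2))) \<inter> cdom S j"
        have "open (param M i ` (ball z R \<inter> ball c (R / 2)))"
          by (rule open_param_image[OF M(1) i(1)]) (use ball_R in auto)
        then have "open W" unfolding W_def
          using cont open_cdom[OF S(1) j'(1)] by (intro open_Int open_vimage)
        then have "open (coord S j ` W)"
          by (intro open_coord_image[OF S(1) j'(1)]) (auto simp: W_def)
        moreover have "coord S j p \<in> coord S j ` W"
        proof (rule imageI)
          have "u \<in> ball z R \<inter> ball c (R / 2)" using coord_O1[OF yp(1)] yp(2) by (simp add: u_def dist_commute)
          moreover have "y p = param M i u"
            unfolding u_def using param_coord[OF M(1) i(1)] yp(1) O1_cdom by auto
          ultimately show "p \<in> W" unfolding W_def using j'(2) by blast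
        qed
        moreover have "norm (Y x - c) = (f \<circ> param S j) x" if x_in: "x \<in> coord S j ` W" for x
        proof -
          obtain q where q: "q \<in> W" "x = coord S j q" using x_in by blast
          then obtain t where t: "y q = param M i t" "t \<in> ball z R" "t \<in> ball c (R / 2)"
            by (auto simp: W_def)
          have "param S j x = q" using q param_coord[OF S(1) j'(1)] by (simp add: W_def)
          moreover have "coord M i (y q) = t"
            using t ball_R coord_param[OF M(1) i(1)] by auto
          moreover have "y q \<in> O1" using t by (auto simp: O1_def)
          ultimately show ?thesis
            using t(3) by (simp add: f_def G_def Y_def dist_norm norm_minus_commute)
        qed
        ultimately have "((f \<circ> param S j) has_derivative (\<lambda>v. inner (L v) (sgn (u - c)))) (at (coord S j p))"
          by (rule has_derivative_transform_within_open[OF d])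
        moreover obtain v where v: "L v = - sgn (u - c)" using L(2) by (metis surjD)
        have unit: "norm (sgn (u - c)) = 1" using \<open>u \<noteq> c\<close> by (simp add: norm_sgn)
        have "metric M i (y p) (L v) (L v) \<le> C"
        proof -
          have "u \<in> cball z R" using coord_O1[OF yp(1)] by (simp add: u_def)
          moreover have "param M i u = y p"
            unfolding u_def using param_coord[OF M(1) i(1)] yp(1) O1_cdom by auto
          ultimately show ?thesis using C[of u "L v"] unit by (simp add: v)
        qed
        then have "\<kappa> * sqrt (metric M i (y p) (L v) (L v)) \<le> \<kappa> * sqrt \<bar>C\<bar>"
          using \<open>\<kappa> \<ge> 0\<close> by (intro mult_left_mono) auto
        then have "sqrt (metric S j p v v) < \<kappa> * sqrt \<bar>C\<bar> + 1" using L(3)[of v] by linarith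
        ultimately have "- (1 / 2) \<le> inner (L v) (sgn (u - c))" using crit[OF j] by blast
        moreover have "inner (sgn (u - c)) (sgn (u - c)) = 1"
          using unit by (simp add: dot_square_norm)
        ultimately show False by (simp add: v)
      qed
      then have "y p = m'"
        using param_coord[OF M(1) i(1), of "y p"] yp(1) O1_cdom by (auto simp: u_def c(2))
      then show ?thesis by blast
    qed
    have "ball z (R / 4) \<subseteq> ball z R" using \<open>R > 0\<close> by (intro subset_ball) simp
    then have "open V" unfolding V_def
      using ball_R by (intro open_param_image[OF M(1) i(1) open_ball]) blast
    then have "openin (top_of_set UNIV) V" by simp
    moreover have a: "a \<in> V" unfolding V_def
      by (rule image_eqI[of _ _ z]) (use \<open>R > 0\<close> in \<open>simp_all add: z_def param_coord[OF M(1) i]\<close>)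
    ultimately show "\<exists>T. openin (top_of_set UNIV) T \<and> a \<in> T \<and> (\<forall>x\<in>T. (x \<in> range y) = (a \<in> range y))"
      using reach[OF _ a] reach[OF a] by (intro exI[of _ V] conjI ballI iffI)
  qed
  then show ?thesis unfolding constant_on_def by blast
qed

section \<open>Hypersurfaces of pseudo-hyperbolic manifolds\<close>

lemma coord_pseudo_hyperbolic: "coord (pseudo_hyperbolic M) i z = (fst z, coord M i (snd z))"
  by (simp add: pseudo_hyperbolic_def case_prod_beta)

lemma charts_at_pseudo_hyperbolic: "charts_at (pseudo_hyperbolic M) z = charts_at M (snd z)"
  by (simp add: pseudo_hyperbolic_def charts_at_def mem_Times_iff)

lemma chart_at_pseudo_hyperbolic: "chart_at (pseudo_hyperbolic M) z = chart_at M (snd z)"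
  by (simp add: chart_at_def charts_at_pseudo_hyperbolic)

lemma metric_pseudo_hyperbolic:
  "metric (pseudo_hyperbolic M) i z u v =
     fst u * fst v + exp (2 * fst z) * metric M i (snd z) (snd u) (snd v)"
  by (simp add: pseudo_hyperbolic_def case_prod_beta)

text \<open>
  The range of an injective linear map into a space with one more dimension is a hyperplane, so it
  equals any hyperplane which contains it. For the differential of a hypersurface this says that every vector
  orthogonal to the normal is tangent.
\<close>

lemma kernel_subset_range:
  fixes d :: "'a::euclidean_space \<Rightarrow> 'b::euclidean_space" and \<phi> :: "'b \<Rightarrow> real"
  assumes "linear d" "inj d" "DIM('b) = DIM('a) + 1"
    and "linear \<phi>" "\<phi> n \<noteq> 0" "\<And>v. \<phi> (d v) = 0" "\<phi> u = 0"
  shows "u \<in> range d"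
proof -
  have sub: "subspace {u. \<phi> u = 0}" using \<open>linear \<phi>\<close> by (rule linear_subspace_kernel)
  have "span {u. \<phi> u = 0} \<noteq> UNIV" using \<open>\<phi> n \<noteq> 0\<close> sub by (auto simp: span_eq_iff[THEN iffD2])
  then have "dim {u. \<phi> u = 0} \<noteq> DIM('b)" by (simp add: dim_eq_full)
  then have "dim {u. \<phi> u = 0} \<le> DIM('a)" using dim_subset_UNIV[of "{u. \<phi> u = 0}"] assms(3) by simp
  moreover have "dim (range d) = DIM('a)"
    using dim_image_eq[OF assms(1), of UNIV] assms(2) by simp
  moreover have "subspace (range d)" using assms(1) linear_subspace_image subspace_UNIV by blast
  ultimately have "range d = {u. \<phi> u = 0}"
    using sub assms(6) by (intro subspace_dim_equal) auto
  then show ?thesis using assms(7) by blast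
qed

context
  fixes M :: "('i, 'm::{t2_space, second_countable_topology}, real^'n) rmfd"
    and S :: "('j, 's::{t2_space, second_countable_topology}, real^'n) rmfd"
    and x :: "'s \<Rightarrow> real \<times> 'm"
    and N :: "'i \<Rightarrow> 's \<Rightarrow> real \<times> (real^'n)"
  assumes M: "riemannian_manifold M" and S: "riemannian_manifold S"
    and x: "isometric_immersion S (pseudo_hyperbolic M) x"
    and N: "unit_normal_field S (pseudo_hyperbolic M) x N"
begin

lemma differential_has_derivative:
  assumes j: "j \<in> charts_at S q" and i: "i \<in> charts_at M (snd (x q))"
  shows "((coord (pseudo_hyperbolic M) i \<circ> x \<circ> param S j) has_derivative
      differential S (pseudo_hyperbolic M) x j i q) (at (coord S j q))"
  unfolding differential_def
proof (rule smooth_on_has_derivative)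
  let ?T = "pseudo_hyperbolic M"
  have "j \<in> indices S" "i \<in> indices ?T" "x q \<in> cdom ?T i" "q \<in> cdom S j"
    using j i charts_at_pseudo_hyperbolic[of M "x q"] by (auto simp: charts_at_def)
  then show "smooth_on (coord S j ` (cdom S j \<inter> x -` cdom ?T i)) (coord ?T i \<circ> x \<circ> param S j)"
    "coord S j q \<in> coord S j ` (cdom S j \<inter> x -` cdom ?T i)"
    using x by (auto simp: isometric_immersion_def smooth_map_def)
qed

lemma height_has_derivative:
  assumes j: "j \<in> charts_at S q" and i: "i \<in> charts_at M (snd (x q))"
  shows "(((fst \<circ> x) \<circ> param S j) has_derivative
      (\<lambda>v. fst (differential S (pseudo_hyperbolic M) x j i q v))) (at (coord S j q))"
  using has_derivative_fst[OF differential_has_derivative[OF assms]]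
  by (simp add: o_def coord_pseudo_hyperbolic)

lemma isometric:
  assumes j: "j \<in> charts_at S q" and i: "i \<in> charts_at M (snd (x q))"
  shows "inj (differential S (pseudo_hyperbolic M) x j i q)"
    "metric S j q v w = metric (pseudo_hyperbolic M) i (x q)
      (differential S (pseudo_hyperbolic M) x j i q v) (differential S (pseudo_hyperbolic M) x j i q w)"
  using x assms unfolding isometric_immersion_def charts_at_pseudo_hyperbolic by blast+

lemma bilinear_ambient:
  assumes i: "i \<in> charts_at M (snd z)"
  shows "bilinear (metric (pseudo_hyperbolic M) i z)"
  unfolding bilinear_def
  using bilinear_ladd[OF bilinear_metric[OF M i]] bilinear_radd[OF bilinear_metric[OF M i]]
    bilinear_lmul[OF bilinear_metric[OF M i]] bilinear_rmul[OF bilinear_metric[OF M i]]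
  by (auto intro!: linearI simp: metric_pseudo_hyperbolic algebra_simps)

lemma ambient_definite:
  assumes i: "i \<in> charts_at M (snd z)" and "metric (pseudo_hyperbolic M) i z u u = 0"
  shows "u = 0"
proof -
  have "fst u * fst u \<ge> 0" "exp (2 * fst z) * metric M i (snd z) (snd u) (snd u) \<ge> 0"
    using metric_nonneg[OF M i] by auto
  with assms(2) have "fst u * fst u = 0" "exp (2 * fst z) * metric M i (snd z) (snd u) (snd u) = 0"
    unfolding metric_pseudo_hyperbolic by linarith+
  then have "fst u = 0" "snd u = 0"
    using metric_pos[OF M i, of "snd u"] by auto
  then show ?thesis by (simp add: prod_eq_iff)
qed

text \<open>
  The vector \<open>u = \<partial>\<^sub>t - \<theta> N\<close> is orthogonal to \<open>N\<close>, hence the image of a tangent vector \<open>w\<close> of the hypersurface, the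
  gradient of the height. Both its squared length and the derivative of the height along it are
  \<open>1 - \<theta>\<^sup>2\<close>. If this is zero, then \<open>u = 0\<close> and \<open>\<partial>\<^sub>t\<close> is normal to the hypersurface.
\<close>

lemma height_gradient:
  assumes j: "j \<in> charts_at S q" and i: "i = chart_at M (snd (x q))"
  defines "d \<equiv> differential S (pseudo_hyperbolic M) x j i q" and "\<theta> \<equiv> angle_function M x N q"
  shows "\<exists>w. fst (d w) = 1 - \<theta>\<^sup>2 \<and> metric S j q w w = 1 - \<theta>\<^sup>2"
    "0 \<le> 1 - \<theta>\<^sup>2"
    "1 - \<theta>\<^sup>2 = 0 \<Longrightarrow> fst (d v) = 0"
proof -
  define g where "g = metric (pseudo_hyperbolic M) i (x q)"
  define n where "n = N i q"
  have i': "i \<in> charts_at M (snd (x q))" unfolding i by (rule chart_at[OF M])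
  have bil: "bilinear g" unfolding g_def by (rule bilinear_ambient[OF i'])
  have metric_0: "metric M i (snd (x q)) v 0 = 0" for v
    using bilinear_rzero[OF bilinear_metric[OF M i']] .
  have g_dt: "g v (1, 0) = fst v" for v
    by (simp add: g_def metric_pseudo_hyperbolic metric_0)
  have g_sym: "g u v = g v u" for u v
  proof -
    have "metric M i (snd (x q)) v w = metric M i (snd (x q)) w v" for v w
      using riem_metric[OF M] i' unfolding riemannian_metric_def by blast
    then show ?thesis by (simp add: g_def metric_pseudo_hyperbolic mult.commute)
  qed
  have nn: "g n n = 1" and nd: "g n (d v) = 0" for v
    using N j i' unfolding unit_normal_field_def charts_at_pseudo_hyperbolic g_def n_def d_def by blast+
  have \<theta>: "\<theta> = g n (1, 0)"
    by (simp add: \<theta>_def angle_function_def Let_def g_def n_def i chart_at_pseudo_hyperbolic)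
  define u where "u = (1, 0) - \<theta> *\<^sub>R n"
  have gu: "g v u = fst v - \<theta> * g v n" for v
    by (simp add: u_def bilinear_rsub[OF bil] bilinear_rmul[OF bil] g_dt)
  have "g n u = 0" using \<theta> by (simp add: gu nn g_dt)
  moreover have "linear d"
    using differential_has_derivative[OF j i'] unfolding d_def by (rule has_derivative_linear)
  moreover have "inj d" unfolding d_def by (rule isometric(1)[OF j i'])
  moreover have "linear (g n)" using bil unfolding bilinear_def by blast
  ultimately obtain w where w: "d w = u"
    using kernel_subset_range[of d "g n" n u] nn nd by auto
  have fst_u: "fst u = 1 - \<theta>\<^sup>2" using \<theta> by (simp add: u_def g_dt power2_eq_square)
  have guu: "g u u = 1 - \<theta>\<^sup>2" using \<open>g n u = 0\<close> g_sym[of n u] by (simp add: gu[of u] fst_u)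
  show "\<exists>w. fst (d w) = 1 - \<theta>\<^sup>2 \<and> metric S j q w w = 1 - \<theta>\<^sup>2"
    using isometric(2)[OF j i', of w w] w fst_u guu by (auto simp: d_def g_def)
  show "0 \<le> 1 - \<theta>\<^sup>2"
    using metric_nonneg[OF S j, of w] isometric(2)[OF j i', of w w] w guu by (simp add: d_def g_def)
  show "fst (d v) = 0" if "1 - \<theta>\<^sup>2 = 0"
  proof -
    have "u = 0" using ambient_definite[OF i', of u] guu that by (simp add: g_def)
    then have "g (d v) u = 0" using bilinear_rzero[OF bil] by simp
    then show ?thesis using gu[of "d v"] g_sym[of "d v" n] nd[of v] by simp
  qed
qed

lemma continuous_immersion: "continuous_on UNIV x"
  using x by (simp add: isometric_immersion_def smooth_map_def)

text \<open>
  Otherwise the height increases along its gradient, of length \<open>sqrt \<epsilon>\<close>, at the rate \<open>\<epsilon> > 0\<close> at every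
  point, whereas it would have to increase at a rate of at most \<open>\<epsilon> / 2\<close> at an almost critical point of
  the bounded function \<open>-h\<close>.
\<close>

lemma angle_eq_1_if_bounded:
  assumes "complete_manifold S" "helix_type M x N" "in_slab x"
  shows "1 - (angle_function M x N q)\<^sup>2 = 0"
proof (rule ccontr)
  obtain \<theta> where \<theta>: "\<And>q. angle_function M x N q = \<theta>" using assms(2) by (auto simp: helix_type_def)
  define \<epsilon> where "\<epsilon> = 1 - \<theta>\<^sup>2"
  assume "1 - (angle_function M x N q)\<^sup>2 \<noteq> 0"
  then have "\<epsilon> > 0" using height_gradient(2)[OF chart_at[OF S] refl] by (simp add: \<theta> \<epsilon>_def less_le)
  obtain t1 t2 where "range x \<subseteq> {t1..t2} \<times> UNIV" using assms(3) by (auto simp: in_slab_def)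
  then have bounded: "- t2 \<le> - fst (x q)" for q by (auto simp: image_subset_iff mem_Times_iff)
  have cont: "continuous_on UNIV (\<lambda>q. - fst (x q))"
    by (intro continuous_on_minus continuous_on_fst continuous_immersion)
  then obtain a where a: "\<And>j D v. j \<in> charts_at S a \<Longrightarrow>
      (((\<lambda>q. - fst (x q)) \<circ> param S j) has_derivative D) (at (coord S j a)) \<Longrightarrow>
       sqrt (metric S j a v v) < sqrt \<epsilon> + 1 \<Longrightarrow> - (\<epsilon> / 2) \<le> D v"
    using almost_critical_point[OF S assms(1) cont bounded, of "sqrt \<epsilon> + 1" "\<epsilon> / 2"] \<open>\<epsilon> > 0\<close>
    by (metis add_pos_nonneg add.commute half_gt_zero real_sqrt_ge_zero less_imp_le zero_less_one)
  have j: "chart_at S a \<in> charts_at S a" by (rule chart_at[OF S])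
  have i: "chart_at M (snd (x a)) \<in> charts_at M (snd (x a))" by (rule chart_at[OF M])
  obtain w where w: "fst (differential S (pseudo_hyperbolic M) x (chart_at S a) (chart_at M (snd (x a))) a w) = \<epsilon>"
    "metric S (chart_at S a) a w w = \<epsilon>"
    using height_gradient(1)[OF j refl] by (auto simp: \<theta> \<epsilon>_def)
  have "- (\<epsilon> / 2) \<le> - fst (differential S (pseudo_hyperbolic M) x (chart_at S a) (chart_at M (snd (x a))) a w)"
    using has_derivative_minus[OF height_has_derivative[OF j i]] w(2)
    by (intro a[OF j]) (auto simp: o_def)
  then show False using w(1) \<open>\<epsilon> > 0\<close> by simp
qed

text \<open>
  In a slice the first component of the differential of the immersion vanishes, so its second component is
  injective, hence bijective for dimension reasons, and multiplies lengths by \<open>exp (-t)\<close>.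
\<close>

lemma slice_if_height_constant:
  assumes "complete_manifold S" "connected (UNIV :: 'm set)" and h: "\<And>q. fst (x q) = t"
  shows "is_slice x"
proof -
  have "surj (snd \<circ> x)"
  proof (rule surj_if_locally_expanding[OF S assms(1) M assms(2)])
    show "continuous_on UNIV (snd \<circ> x)"
      unfolding o_def by (intro continuous_on_snd continuous_immersion)
    show "0 \<le> exp t" by simp
    fix q i j assume j: "j \<in> charts_at S q" and "i \<in> charts_at M ((snd \<circ> x) q)"
    then have i: "i \<in> charts_at M (snd (x q))" by simp
    define d where "d = differential S (pseudo_hyperbolic M) x j i q"
    note deriv = differential_has_derivative[OF j i, folded d_def]
    have "((\<lambda>y. t) has_derivative (\<lambda>v. fst (d v))) (at (coord S j q))"
      using height_has_derivative[OF j i] by (simp add: d_def o_def h)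
    then have fst_d: "fst (d v) = 0" for v
      using has_derivative_unique[OF _ has_derivative_const] by metis
    have lin: "linear (\<lambda>v. snd (d v))"
      using has_derivative_linear[OF has_derivative_snd[OF deriv]] .
    have "inj d" unfolding d_def by (rule isometric(1)[OF j i])
    then have "inj (\<lambda>v. snd (d v))"
      using fst_d by (auto simp: inj_def prod_eq_iff)
    then have "surj (\<lambda>v. snd (d v))"
      by (rule linear_injective_imp_surjective[OF lin _ refl])
    moreover have "((coord M i \<circ> (snd \<circ> x) \<circ> param S j) has_derivative (\<lambda>v. snd (d v))) (at (coord S j q))"
      using has_derivative_snd[OF deriv] by (simp add: o_def coord_pseudo_hyperbolic)
    moreover have "sqrt (metric S j q v v) \<le>
        exp t * sqrt (metric M i ((snd \<circ> x) q) (snd (d v)) (snd (d v)))" for v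
    proof -
      have "metric S j q v v = (exp t)\<^sup>2 * metric M i (snd (x q)) (snd (d v)) (snd (d v))"
        using isometric(2)[OF j i, of v v] fst_d[of v]
        by (simp add: d_def metric_pseudo_hyperbolic h exp_double)
      then show ?thesis by (simp add: real_sqrt_mult)
    qed
    ultimately show "\<exists>L. ((coord M i \<circ> (snd \<circ> x) \<circ> param S j) has_derivative L) (at (coord S j q)) \<and> surj L \<and>
        (\<forall>v. sqrt (metric S j q v v) \<le> exp t * sqrt (metric M i ((snd \<circ> x) q) (L v) (L v)))"
      by blast
  qed
  then have "\<exists>q. x q = (t, m)" for m
    using h by (metis comp_apply prod.collapse surjD)
  then have "(t, m) \<in> range x" for m by (metis rangeI)
  moreover have "x q \<in> {t} \<times> UNIV" for q using h by (simp add: mem_Times_iff)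
  ultimately have "range x = {t} \<times> UNIV" by blast
  then show ?thesis by (auto simp: is_slice_def)
qed

end

theorem corollary4p9:
  fixes M :: "('i, 'm::{t2_space, second_countable_topology}, real^'n) rmfd"
    and \<Sigma> :: "('j, 's::{t2_space, second_countable_topology}, real^'n) rmfd"
    and x :: "'s \<Rightarrow> real \<times> 'm"
    and N :: "'i \<Rightarrow> 's \<Rightarrow> real \<times> (real^'n)"
    and p :: real
  assumes "CARD('n) \<ge> 2"
    and "riemannian_manifold M" and "connected (UNIV :: 'm set)" and "oriented M"
    and "riemannian_manifold \<Sigma>" and "connected (UNIV :: 's set)"
    and "isometric_immersion \<Sigma> (pseudo_hyperbolic M) x"
    and "unit_normal_field \<Sigma> (pseudo_hyperbolic M) x N"
    and "complete_manifold \<Sigma>" and "\<not> compact (UNIV :: 's set)"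
    and "helix_type M x N"
    and "in_slab x"
    and "p > 2" and "first_eigenvalue \<Sigma> p = 0"
    and "\<forall>q. (mean_curvature \<Sigma> (pseudo_hyperbolic M) x N q)\<^sup>2 \<le> 1"
  shows "is_slice x"
proof -
  note hyps = \<open>riemannian_manifold M\<close> \<open>riemannian_manifold \<Sigma>\<close>
    \<open>isometric_immersion \<Sigma> (pseudo_hyperbolic M) x\<close> \<open>unit_normal_field \<Sigma> (pseudo_hyperbolic M) x N\<close>
  have angle: "1 - (angle_function M x N q)\<^sup>2 = 0" for q
    by (rule angle_eq_1_if_bounded[OF hyps \<open>complete_manifold \<Sigma>\<close> \<open>helix_type M x N\<close> \<open>in_slab x\<close>])
  have "((fst \<circ> x) \<circ> param \<Sigma> j has_derivative (\<lambda>v. 0)) (at (coord \<Sigma> j q))"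
    if "j \<in> charts_at \<Sigma> q" for j q
    using height_has_derivative[OF hyps that chart_at[OF hyps(1)]]
    by (simp only: height_gradient(3)[OF hyps that refl angle])
  from constant_if_derivative_zero[OF hyps(2) \<open>connected (UNIV :: 's set)\<close> this]
  obtain t where "\<And>q. fst (x q) = t" by auto
  then show "is_slice x"
    by (rule slice_if_height_constant[OF hyps \<open>complete_manifold \<Sigma>\<close> \<open>connected (UNIV :: 'm set)\<close>])
qed

end
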